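(* The problem Barrier-Coverage can be solved in time $2^{2B^2(B+1)}\cdot n^{O(1)}$.
   Context: Barrier-Coverage: the input consists of sensors $(x_1,r_1),\dots,(x_n,r_n)$ with $x_i,r_i\in\mathbb{N}$ for all $i$, and $L\in\mathbb{N}$, $B\in\mathbb{N}$. The question is whether there exists $y\in\mathbb{R}^n$ with $[0,L]\subseteq\bigcup_i[y_i-r_i,y_i+r_i]$ and $\sum_i|y_i-x_i|\le B$. *)

theory Defs
  imports Complex_Main
begin

text \<open>A sensor is a pair (x, r) of natural numbers: position and radius.
  An instance is a list of sensors together with L and B.\<close>

definition barrier_coverage :: "(nat \<times> nat) list \<Rightarrow> nat \<Rightarrow> nat \<Rightarrow> bool" where
  "barrier_coverage sens L B \<longleftrightarrow>
     (\<exists>y :: nat \<Rightarrow> real.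
        {0 .. real L} \<subseteq> (\<Union>i<length sens. {y i - real (snd (sens ! i)) .. y i + real (snd (sens ! i))})
      \<and> (\<Sum>i<length sens. \<bar>y i - real (fst (sens ! i))\<bar>) \<le> real B)"

type_synonym state = "(nat \<Rightarrow> int) \<times> (int \<Rightarrow> int)"

datatype aexp = N int | Reg nat | Load aexp | Plus aexp aexp | Minus aexp aexp | Half aexp

datatype bexp = Less aexp aexp | Not bexp | And bexp bexp

datatype com = Skip | Assign nat aexp | Store aexp aexp | Seq com com
  | If bexp com com | While bexp com

fun aval :: "aexp \<Rightarrow> state \<Rightarrow> int" where
  "aval (N k) s = k"
| "aval (Reg r) s = fst s r"
| "aval (Load a) s = snd s (aval a s)"
| "aval (Plus a b) s = aval a s + aval b s"
| "aval (Minus a b) s = aval a s - aval b s"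
| "aval (Half a) s = aval a s div 2"

fun bval :: "bexp \<Rightarrow> state \<Rightarrow> bool" where
  "bval (Less a b) s = (aval a s < aval b s)"
| "bval (Not b) s = (\<not> bval b s)"
| "bval (And b c) s = (bval b s \<and> bval c s)"

inductive big_step :: "com \<Rightarrow> state \<Rightarrow> nat \<Rightarrow> state \<Rightarrow> bool" where
  Skip: "big_step Skip s 1 s"
| Assign: "big_step (Assign r a) s 1 ((fst s)(r := aval a s), snd s)"
| Store: "big_step (Store a b) s 1 (fst s, (snd s)(aval a s := aval b s))"
| Seq: "big_step c1 s t1 s1 \<Longrightarrow> big_step c2 s1 t2 s2 \<Longrightarrow> big_step (Seq c1 c2) s (t1 + t2) s2"
| IfT: "bval b s \<Longrightarrow> big_step c1 s t s' \<Longrightarrow> big_step (If b c1 c2) s (Suc t) s'"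
| IfF: "\<not> bval b s \<Longrightarrow> big_step c2 s t s' \<Longrightarrow> big_step (If b c1 c2) s (Suc t) s'"
| WhileF: "\<not> bval b s \<Longrightarrow> big_step (While b c) s 1 s"
| WhileT: "bval b s \<Longrightarrow> big_step c s t1 s1 \<Longrightarrow> big_step (While b c) s1 t2 s2
           \<Longrightarrow> big_step (While b c) s (Suc (t1 + t2)) s2"

definition init_state :: "(nat \<times> nat) list \<Rightarrow> nat \<Rightarrow> nat \<Rightarrow> state" where
  "init_state sens L B =
     (\<lambda>_. 0,
      \<lambda>a. if a = 0 then int (length sens)
          else if a = 1 then int L
          else if a = 2 then int B
          else if 3 \<le> a \<and> a < 3 + 2 * int (length sens) then
            (if even (nat (a - 3)) then int (fst (sens ! (nat (a - 3) div 2)))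
             else int (snd (sens ! (nat (a - 3) div 2))))
          else 0)"

definition decides_in_time :: "com \<Rightarrow> ((nat \<times> nat) list \<Rightarrow> nat \<Rightarrow> nat \<Rightarrow> bool)
    \<Rightarrow> ((nat \<times> nat) list \<Rightarrow> nat \<Rightarrow> nat \<Rightarrow> nat) \<Rightarrow> bool" where
  "decides_in_time P Q T \<longleftrightarrow>
     (\<forall>sens L B. \<exists>t s'. big_step P (init_state sens L B) t s' \<and> t \<le> T sens L B
                      \<and> (fst s' 0 = 1 \<longleftrightarrow> Q sens L B))"

end

theory Submission
  imports Defs
begin

text \<open>
  Rounding all positions with a common offset preserves coverage, and on average over the offset it
  preserves the cost; so displacements may be assumed integral.

  Consider the leftmost uncovered unit cell. A sensor that covers it in a solution must be moved there, so one of
  its ends is within distance \<open>B\<close> of the cell; this leaves \<open>2 B\<close> classes of sensors sharing such an end.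
  In each class an exchange argument shows that one of the two longest sensors is moved
  without loss of generality. Guessing class, sensor and displacement takes at most \<open>2 B + 3\<close> bits,
  and every move costs at least 1, so a run uses at most \<open>B (2 B + 3)\<close> bits. Trying all bit strings takes
  time \<open>2 ^ (B (2 B + 3))\<close> times a polynomial in \<open>n\<close> and \<open>B\<close>, which is within the claimed bound.
\<close>

section \<open>Integral displacements\<close>

text \<open>The running time must not depend on \<open>L\<close>, so no step may walk over the cells
  of the barrier: gaps are found by jumping from one right end to the next. Always moving the
  longest sensor of a class would be wrong, since it may be needed exactly where it stands; but if
  the two longest both stay, the shorter lies inside the longer and is free. One bit chooses between
  them. The \<open>2 B + 3\<close> bits are this bit, the side, the sign, and two unary numbers, the
  distance of the near end and the displacement minus one, each at most \<open>B - 1\<close> and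
  hence at most \<open>B\<close> bits long with its terminator. A sensor is settled once decided, so
  that completeness can charge each displacement of a solution in one piece; soundness rests on the
  triangle inequality instead. The claimed exponent is cubic in \<open>B\<close> while the search
  uses a quadratic one, and this slack absorbs all polynomial factors in \<open>B\<close>.\<close>

lemma sum_div_shift:
  assumes "M > 0"
  shows "(\<Sum>j<M. (m + int j) div int M) = m"
proof -
  let ?S = "\<lambda>m. \<Sum>j<M. (m + int j) div int M"
  \<comment> \<open>Raising \<open>m\<close> by one drops the summand \<open>m div int M\<close> and
    appends \<open>(m + int M) div int M\<close>, which is one larger.\<close>
  have step: "?S (m + 1) = ?S m + 1" for m
  proof -
    have "(\<Sum>j<Suc M. (m + int j) div int M) = m div int M + (\<Sum>j<M. (m + 1 + int j) div int M)"
      by (subst sum.lessThan_Suc_shift) (simp add: algebra_simps)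
    moreover have "(\<Sum>j<Suc M. (m + int j) div int M) = ?S m + (m + int M) div int M"
      by simp
    moreover have "(m + int M) div int M = m div int M + 1"
      using assms by simp
    ultimately show ?thesis by linarith
  qed
  show ?thesis
  proof (induction m rule: int_induct[where k = 0])
    case base
    then show ?case by (intro sum.neutral) (auto simp: div_pos_pos_trivial)
  next
    case (step1 i)
    then show ?case using step[of i] by simp
  next
    case (step2 i)
    then show ?case using step[of "i - 1"] by simp
  qed
qed

text \<open>Hermite's identity. Scaling by \<open>M\<close> turns the floors into integer divisions
  of \<open>\<lfloor>real M * y\<rfloor> + int j\<close> by \<open>M\<close>.\<close>

lemma sum_floor_shift:
  assumes "M > 0"
  shows "(\<Sum>j<M. \<lfloor>y + real j / real M\<rfloor>) = \<lfloor>real M * y\<rfloor>"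
proof -
  have "\<lfloor>y + real j / real M\<rfloor> = (\<lfloor>real M * y\<rfloor> + int j) div int M" for j
  proof -
    have "y + real j / real M = (real M * y + real j) / real_of_int (int M)"
      using assms by (simp add: field_simps)
    then have "\<lfloor>y + real j / real M\<rfloor> = \<lfloor>real M * y + real j\<rfloor> div int M"
      by (metis floor_divide_real_eq_div of_nat_0_le_iff)
    moreover have "\<lfloor>real M * y + real j\<rfloor> = \<lfloor>real M * y\<rfloor> + int j"
      by linarith
    ultimately show ?thesis by simp
  qed
  then show ?thesis using sum_div_shift[OF assms] by simp
qed

text \<open>Offsets below 1 leave all rounded values on the same side of the integer
  \<open>x\<close> as \<open>y\<close>, so the absolute values open uniformly and Hermite's identity
  applies. The \<open>+ 1\<close> pays for the floor of \<open>real M * y\<close> when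
  \<open>y < x\<close>.\<close>

lemma sum_abs_floor_shift_le:
  fixes x :: int
  assumes "M > 0"
  shows "(\<Sum>j<M. real_of_int \<bar>\<lfloor>y + real j / real M\<rfloor> - x\<bar>) \<le> real M * \<bar>y - x\<bar> + 1"
proof (cases "x \<le> y")
  case True
  have "x \<le> \<lfloor>y + real j / real M\<rfloor>" for j
    using True by (simp add: le_floor_iff add_increasing2)
  then have "(\<Sum>j<M. real_of_int \<bar>\<lfloor>y + real j / real M\<rfloor> - x\<bar>)
      = real_of_int (\<Sum>j<M. \<lfloor>y + real j / real M\<rfloor> - x)"
    unfolding of_int_sum by (intro sum.cong) auto
  also have "\<dots> = \<lfloor>real M * y\<rfloor> - M * x"
    by (simp add: sum_subtractf sum_floor_shift[OF assms])
  also have "\<dots> \<le> real M * (y - x)"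
    by (simp add: algebra_simps)
  finally show ?thesis using True by simp
next
  case False
  have "\<lfloor>y + real j / real M\<rfloor> \<le> x" if "j < M" for j
  proof -
    have "real j / real M < 1" using that by simp
    then show ?thesis using False by linarith
  qed
  then have "(\<Sum>j<M. real_of_int \<bar>\<lfloor>y + real j / real M\<rfloor> - x\<bar>)
      = real_of_int (\<Sum>j<M. x - \<lfloor>y + real j / real M\<rfloor>)"
    unfolding of_int_sum by (intro sum.cong) auto
  also have "\<dots> = M * x - \<lfloor>real M * y\<rfloor>"
    by (simp add: sum_subtractf sum_floor_shift[OF assms])
  also have "\<dots> \<le> real M * (x - y) + 1"
    by (simp add: algebra_simps) linarith
  finally show ?thesis using False by simp
qed

text \<open>
  Rounding by \<open>\<lfloor>y + \<theta>\<rfloor>\<close> does not change the average cost over all offsets \<open>\<theta>\<close>; sampling more than \<open>n\<close> offsets keeps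
  the error below 1, which suffices because the cost is an integer.
\<close>

lemma rounding_cost:
  fixes y :: "nat \<Rightarrow> real" and x :: "nat \<Rightarrow> int"
  assumes "(\<Sum>i<n. \<bar>y i - x i\<bar>) \<le> real B"
  obtains \<theta> :: real where "0 \<le> \<theta>" "\<theta> < 1" "(\<Sum>i<n. \<bar>\<lfloor>y i + \<theta>\<rfloor> - x i\<bar>) \<le> int B"
proof -
  define M where "M = Suc n"
  have "\<exists>j<M. (\<Sum>i<n. \<bar>\<lfloor>y i + real j / real M\<rfloor> - x i\<bar>) \<le> int B"
  proof (rule ccontr)
    assume "\<not> ?thesis"
    then have big: "int B + 1 \<le> (\<Sum>i<n. \<bar>\<lfloor>y i + real j / real M\<rfloor> - x i\<bar>)" if "j < M" for j
      using that by (metis linorder_not_le zless_imp_add1_zle)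
    have "(\<Sum>j<M. int B + 1) \<le> (\<Sum>j<M. \<Sum>i<n. \<bar>\<lfloor>y i + real j / real M\<rfloor> - x i\<bar>)"
      by (intro sum_mono) (use big in auto)
    then have "M * (int B + 1) \<le> (\<Sum>j<M. \<Sum>i<n. \<bar>\<lfloor>y i + real j / real M\<rfloor> - x i\<bar>)"
      by simp
    then have "real_of_int (M * (int B + 1)) \<le> real_of_int (\<Sum>j<M. \<Sum>i<n. \<bar>\<lfloor>y i + real j / real M\<rfloor> - x i\<bar>)"
      by (rule of_int_le_iff[THEN iffD2])
    then have "real M * (real B + 1) \<le> real_of_int (\<Sum>j<M. \<Sum>i<n. \<bar>\<lfloor>y i + real j / real M\<rfloor> - x i\<bar>)"
      by simp
    also have "\<dots> = (\<Sum>i<n. \<Sum>j<M. real_of_int \<bar>\<lfloor>y i + real j / real M\<rfloor> - x i\<bar>)"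
      by (subst sum.swap) simp
    also have "\<dots> \<le> (\<Sum>i<n. real M * \<bar>y i - x i\<bar> + 1)"
      by (intro sum_mono sum_abs_floor_shift_le) (simp add: M_def)
    also have "\<dots> = real M * (\<Sum>i<n. \<bar>y i - x i\<bar>) + n"
      by (simp add: sum.distrib sum_distrib_left)
    also have "\<dots> \<le> real M * real B + n"
      using assms by (simp add: mult_left_mono)
    finally show False by (simp add: M_def algebra_simps)
  qed
  then obtain j where "j < M" "(\<Sum>i<n. \<bar>\<lfloor>y i + real j / real M\<rfloor> - x i\<bar>) \<le> int B" by blast
  then show ?thesis by (intro that[of "real j / real M"]) auto
qed

text \<open>Rounding needs an interval that reaches strictly left of \<open>p\<close>, which the one
  containing \<open>p\<close> need not do. It is found at a point just below \<open>p\<close>,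
  beyond every right end smaller than \<open>p\<close>.\<close>

lemma interval_cover_left_limit:
  fixes a b :: "nat \<Rightarrow> real"
  assumes cov: "{0..R} \<subseteq> (\<Union>i<n. {a i..b i})" and p: "0 < p" "p \<le> R"
  shows "\<exists>i<n. a i < p \<and> p \<le> b i"
proof (rule ccontr)
  assume H: "\<not> ?thesis"
  \<comment> \<open>The 0 makes \<open>S\<close> nonempty and keeps the chosen point
    \<open>q\<close> inside \<open>{0..R}\<close>.\<close>
  define S where "S = insert 0 (b ` {i. i < n \<and> b i < p})"
  have fin: "finite S" unfolding S_def by auto
  have "Max S < p" using fin p unfolding S_def by (subst Max_less_iff) auto
  then obtain q where q: "Max S < q" "q < p" using dense by blast
  have "0 \<le> Max S" using fin by (intro Max_ge) (auto simp: S_def)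
  then have "q \<in> {0..R}" using q p by auto
  then obtain i where i: "i < n" "a i \<le> q" "q \<le> b i" using cov by force
  then have "b i < p" using H q by force
  then have "b i \<le> Max S" using fin i by (intro Max_ge) (auto simp: S_def)
  then show False using i q by simp
qed

definition covers :: "int \<Rightarrow> int \<Rightarrow> (int \<Rightarrow> int) \<Rightarrow> (int \<Rightarrow> int) \<Rightarrow> bool" where
  "covers n L l e \<longleftrightarrow> (\<forall>k. 0 \<le> k \<and> k < L \<longrightarrow> (\<exists>i\<in>{0..<n}. l i \<le> k \<and> k < e i))"

text \<open>The invariant of the search. Freezing the settled sensors ensures that a displacement
  already paid for is never revisited.\<close>

definition solvable :: "int \<Rightarrow> int \<Rightarrow> (int \<Rightarrow> int) \<Rightarrow> (int \<Rightarrow> int) \<Rightarrow> (int \<Rightarrow> int) \<Rightarrow> int \<Rightarrow> bool" where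
  "solvable n L l e u b \<longleftrightarrow> (\<exists>\<delta>. (\<Sum>i\<in>{0..<n}. \<bar>\<delta> i\<bar>) \<le> b \<and> (\<forall>i\<in>{0..<n}. u i \<le> 0 \<longrightarrow> \<delta> i = 0)
     \<and> covers n L (\<lambda>i. l i + \<delta> i) (\<lambda>i. e i + \<delta> i))"

text \<open>
  With integral positions, \<open>[0, L]\<close> is covered iff every unit cell \<open>[k, k + 1]\<close> is covered by a single sensor.
  For \<open>L = 0\<close> there are no cells, and a sensor of radius 0 can matter; lengthening all sensors by one to the right and
  asking for the cell at 0 expresses that the point 0 is covered.
\<close>

lemma barrier_coverage_iff_integer:
  "barrier_coverage sens L B \<longleftrightarrow>
    (\<exists>\<delta> :: nat \<Rightarrow> int. (\<Sum>i<length sens. \<bar>\<delta> i\<bar>) \<le> int B \<and>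
      (\<forall>k. 0 \<le> k \<and> k < max 1 (int L) \<longrightarrow> (\<exists>i<length sens.
         int (fst (sens ! i)) - int (snd (sens ! i)) + \<delta> i \<le> k \<and>
         k < int (fst (sens ! i)) + int (snd (sens ! i)) + (if L = 0 then 1 else 0) + \<delta> i)))"
    (is "?lhs \<longleftrightarrow> (\<exists>\<delta>. ?P \<delta>)")
proof
  let ?n = "length sens"
  let ?x = "\<lambda>i. int (fst (sens ! i))" and ?r = "\<lambda>i. int (snd (sens ! i))"
  {
    assume ?lhs
    then obtain y :: "nat \<Rightarrow> real" where
      cov: "{0..real L} \<subseteq> (\<Union>i<?n. {y i - ?r i .. y i + ?r i})" and
      cost: "(\<Sum>i<?n. \<bar>y i - ?x i\<bar>) \<le> B"
      unfolding barrier_coverage_def by auto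
    from cost obtain \<theta> :: real where \<theta>: "0 \<le> \<theta>" "\<theta> < 1"
      and c: "(\<Sum>i<?n. \<bar>\<lfloor>y i + \<theta>\<rfloor> - ?x i\<bar>) \<le> int B"
      by (rule rounding_cost)
    have "?P (\<lambda>i. \<lfloor>y i + \<theta>\<rfloor> - ?x i)"
    proof (intro conjI allI impI c)
      fix k assume k: "0 \<le> k \<and> k < max 1 (int L)"
      show "\<exists>i<?n. ?x i - ?r i + (\<lfloor>y i + \<theta>\<rfloor> - ?x i) \<le> k \<and>
         k < ?x i + ?r i + (if L = 0 then 1 else 0) + (\<lfloor>y i + \<theta>\<rfloor> - ?x i)"
      proof (cases "L = 0")
        case True
        then obtain i where i: "i < ?n" "y i - ?r i \<le> 0" "0 \<le> y i + ?r i" using cov by force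
        have "\<lfloor>y i + \<theta>\<rfloor> - ?r i \<le> 0" "0 \<le> \<lfloor>y i + \<theta>\<rfloor> + ?r i"
          using i \<theta> by linarith+
        then show ?thesis using i(1) k True by (intro exI[of _ i]) auto
      next
        case False
        \<comment> \<open>Rounding to \<open>\<lfloor>y i + \<theta>\<rfloor>\<close> puts sensor
          \<open>i\<close> over the cell \<open>k\<close> exactly when \<open>y i - ?r i < p\<close>
          and \<open>p \<le> y i + ?r i\<close>.\<close>
        define p where "p = real_of_int k + 1 - \<theta>"
        have "k + 1 \<le> int L" using k False by auto
        then have "real_of_int k + 1 \<le> real L" by linarith
        then have "0 < p" "p \<le> real L" using k \<theta> unfolding p_def by auto
        from interval_cover_left_limit[OF cov this] obtain i where
          i: "i < ?n" "y i - ?r i < p" "p \<le> y i + ?r i" by auto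
        have "\<lfloor>y i + \<theta>\<rfloor> - ?r i \<le> k" "k < \<lfloor>y i + \<theta>\<rfloor> + ?r i"
          using i(2,3) unfolding p_def by linarith+
        then show ?thesis using i(1) False by (intro exI[of _ i]) auto
      qed
    qed
    then show "\<exists>\<delta>. ?P \<delta>" by (rule exI[of ?P])
  }
  {
    assume "\<exists>\<delta>. ?P \<delta>"
    then obtain \<delta> where \<delta>: "?P \<delta>" by blast
    define y where "y i = real_of_int (?x i + \<delta> i)" for i
    have "real_of_int (\<Sum>i<?n. \<bar>\<delta> i\<bar>) \<le> real B" using \<delta> by linarith
    then have "(\<Sum>i<?n. \<bar>y i - real (fst (sens ! i))\<bar>) \<le> real B"
      by (simp add: y_def)
    moreover have "{0..real L} \<subseteq> (\<Union>i<?n. {y i - real (snd (sens ! i)) .. y i + real (snd (sens ! i))})"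
    proof
      fix p assume p: "p \<in> {0..real L}"
      \<comment> \<open>The right end \<open>p = L\<close> starts no cell of its own and is assigned
        to the last one.\<close>
      define k where "k = (if p < real L \<or> L = 0 then \<lfloor>p\<rfloor> else int L - 1)"
      have k: "0 \<le> k \<and> k < max 1 (int L)"
        using p unfolding k_def by (auto simp: floor_less_iff)
      have kp: "real_of_int k \<le> p" "p \<le> real_of_int k + 1" "L = 0 \<Longrightarrow> p = real_of_int k"
        using p unfolding k_def by auto
      from \<delta> k obtain i where i: "i < ?n" "?x i - ?r i + \<delta> i \<le> k"
         "k < ?x i + ?r i + (if L = 0 then 1 else 0) + \<delta> i" by blast
      have "real_of_int (?x i - ?r i + \<delta> i) \<le> k" using i(2) by linarith
      then have "y i - ?r i \<le> p" using kp unfolding y_def by simp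
      moreover have "p \<le> y i + ?r i"
      proof (cases "L = 0")
        case True
        then have "k \<le> ?x i + ?r i + \<delta> i" using i by simp
        then have "real_of_int k \<le> real_of_int (?x i + ?r i + \<delta> i)" by linarith
        then show ?thesis using kp(3)[OF True] by (simp add: y_def)
      next
        case False
        then have "k + 1 \<le> ?x i + ?r i + \<delta> i" using i by simp
        then have "real_of_int k + 1 \<le> real_of_int (?x i + ?r i + \<delta> i)" by linarith
        then show ?thesis using kp(2) by (simp add: y_def)
      qed
      ultimately show "p \<in> (\<Union>i<?n. {y i - real (snd (sens ! i)) .. y i + real (snd (sens ! i))})"
        using i(1) by auto
    qed
    ultimately show ?lhs unfolding barrier_coverage_def by blast
  }
qed

lemma barrier_coverage_iff_solvable:
  assumes l: "\<And>i. i < length sens \<Longrightarrow> l (int i) = int (fst (sens ! i)) - int (snd (sens ! i))"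
    and e: "\<And>i. i < length sens \<Longrightarrow> e (int i) =
      int (fst (sens ! i)) + int (snd (sens ! i)) + (if L = 0 then 1 else 0)"
    and u: "\<And>i. i < length sens \<Longrightarrow> 0 < u (int i)"
  shows "barrier_coverage sens L B \<longleftrightarrow> solvable (int (length sens)) (max 1 (int L)) l e u (int B)"
proof -
  let ?n = "length sens"
  have sum: "(\<Sum>i\<in>{0..<int ?n}. \<bar>\<delta> i\<bar>) = (\<Sum>i<?n. \<bar>\<delta> (int i)\<bar>)" for \<delta> :: "int \<Rightarrow> int"
    by (rule sum.reindex_bij_witness[of _ int nat]) auto
  have ex: "(\<exists>i\<in>{0..<int ?n}. P i) \<longleftrightarrow> (\<exists>i<?n. P (int i))" for P
    by (metis atLeastLessThan_iff nat_0_le nat_less_iff of_nat_0_le_iff of_nat_less_iff)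
  have u': "\<not> u i \<le> 0" if "i \<in> {0..<int ?n}" for i
    using u[of "nat i"] that by (auto simp: nat_less_iff)
  have "solvable (int ?n) (max 1 (int L)) l e u (int B) \<longleftrightarrow>
     (\<exists>\<delta>::int \<Rightarrow> int. (\<Sum>i<?n. \<bar>\<delta> (int i)\<bar>) \<le> int B \<and>
      (\<forall>k. 0 \<le> k \<and> k < max 1 (int L) \<longrightarrow> (\<exists>i<?n.
         l (int i) + \<delta> (int i) \<le> k \<and> k < e (int i) + \<delta> (int i))))"
    unfolding solvable_def covers_def sum ex using u' by blast
  also have "\<dots> \<longleftrightarrow> (\<exists>\<delta>::nat \<Rightarrow> int. (\<Sum>i<?n. \<bar>\<delta> i\<bar>) \<le> int B \<and>
      (\<forall>k. 0 \<le> k \<and> k < max 1 (int L) \<longrightarrow> (\<exists>i<?n.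
         l (int i) + \<delta> i \<le> k \<and> k < e (int i) + \<delta> i)))" (is "?a \<longleftrightarrow> ?b")
  proof
    assume ?a
    then obtain \<delta> where "(\<Sum>i<?n. \<bar>\<delta> (int i)\<bar>) \<le> int B \<and>
      (\<forall>k. 0 \<le> k \<and> k < max 1 (int L) \<longrightarrow> (\<exists>i<?n.
         l (int i) + \<delta> (int i) \<le> k \<and> k < e (int i) + \<delta> (int i)))" by blast
    then show ?b by (intro exI[of _ "\<lambda>i. \<delta> (int i)"])
  next
    assume ?b
    then obtain \<delta> where "(\<Sum>i<?n. \<bar>\<delta> i\<bar>) \<le> int B \<and>
      (\<forall>k. 0 \<le> k \<and> k < max 1 (int L) \<longrightarrow> (\<exists>i<?n.
         l (int i) + \<delta> i \<le> k \<and> k < e (int i) + \<delta> i))" by blast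
    then show ?a by (intro exI[of _ "\<lambda>i. \<delta> (nat i)"]) simp
  qed
  also have "\<dots> \<longleftrightarrow> barrier_coverage sens L B"
    unfolding barrier_coverage_iff_integer using l e by (simp cong: conj_cong)
  finally show ?thesis by simp
qed

section \<open>The search\<close>

text \<open>Not cut off at \<open>L\<close>: finitely many sensors always leave a gap, so coverage
  becomes the comparison \<open>L \<le> first_gap n l e\<close>.\<close>

definition first_gap :: "int \<Rightarrow> (int \<Rightarrow> int) \<Rightarrow> (int \<Rightarrow> int) \<Rightarrow> int" where
  "first_gap n l e = int (LEAST k. \<not> (\<exists>i\<in>{0..<n}. l i \<le> int k \<and> int k < e i))"

lemma gap_exists:
  fixes n :: int and l e :: "int \<Rightarrow> int"
  shows "\<exists>k::nat. \<not> (\<exists>i\<in>{0..<n}. l i \<le> int k \<and> int k < e i)"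
proof -
  define m where "m = nat (\<Sum>i\<in>{0..<n}. \<bar>e i\<bar>)"
  have "e i \<le> int m" if "i \<in> {0..<n}" for i
  proof -
    have "\<bar>e i\<bar> \<le> (\<Sum>i\<in>{0..<n}. \<bar>e i\<bar>)"
      using that by (intro member_le_sum) auto
    then show ?thesis unfolding m_def by linarith
  qed
  then show ?thesis by (intro exI[of _ m]) force
qed

lemma first_gap_uncovered:
  "\<not> (\<exists>i\<in>{0..<n}. l i \<le> first_gap n l e \<and> first_gap n l e < e i)"
  unfolding first_gap_def using LeastI_ex[OF gap_exists[of n l e]] by blast

lemma first_gap_nonneg: "0 \<le> first_gap n l e"
  by (simp add: first_gap_def)

lemma below_first_gap:
  assumes "0 \<le> k" "k < first_gap n l e"
  shows "\<exists>i\<in>{0..<n}. l i \<le> k \<and> k < e i"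
  using assms not_less_Least[of "nat k" "\<lambda>k. \<not> (\<exists>i\<in>{0..<n}. l i \<le> int k \<and> int k < e i)"]
  unfolding first_gap_def by (simp add: nat_less_iff)

lemma first_gap_eqI:
  assumes "0 \<le> c" "covers n c l e" "\<not> (\<exists>i\<in>{0..<n}. l i \<le> c \<and> c < e i)"
  shows "first_gap n l e = c"
proof (rule antisym)
  show "first_gap n l e \<le> c" using below_first_gap[of c n l e] assms by force
  show "c \<le> first_gap n l e"
    using first_gap_uncovered[of n l e] first_gap_nonneg[of n l e] assms(2) unfolding covers_def by force
qed

lemma covers_iff_first_gap:
  "0 \<le> L \<Longrightarrow> covers n L l e \<longleftrightarrow> L \<le> first_gap n l e"
  using below_first_gap[of _ n l e] first_gap_uncovered[of n l e] first_gap_nonneg[of n l e]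
  unfolding covers_def by (meson dual_order.strict_trans1 dual_order.trans linorder_not_le)

text \<open>
  The reflection \<open>k \<mapsto> -1 - k\<close> of the cells turns the interval with ends \<open>l\<close>, \<open>e\<close> into the one with ends \<open>- e\<close>, \<open>- l\<close>.
  So for sensors on either side of a gap, a larger near end is closer to the gap, and at equal near ends
  a smaller far end means a longer sensor.
\<close>

definition near_end :: "bool \<Rightarrow> (int \<Rightarrow> int) \<Rightarrow> (int \<Rightarrow> int) \<Rightarrow> int \<Rightarrow> int" where
  "near_end right l e i = (if right then - l i else e i)"

definition far_end :: "bool \<Rightarrow> (int \<Rightarrow> int) \<Rightarrow> (int \<Rightarrow> int) \<Rightarrow> int \<Rightarrow> int" where
  "far_end right l e i = (if right then - e i else l i)"

text \<open>Written as the left-to-right scan that the program performs, ties included, so that both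
  yield the same index; -1 stands for an empty class.\<close>

primrec pick :: "(int \<Rightarrow> int) \<Rightarrow> (int \<Rightarrow> int) \<Rightarrow> (int \<Rightarrow> int) \<Rightarrow> int \<Rightarrow> nat \<Rightarrow> int" where
  "pick near far u v 0 = - 1"
| "pick near far u v (Suc m) =
    (if 0 < u (int m) \<and> near (int m) = v \<and>
        (pick near far u v m < 0 \<or> far (int m) < far (pick near far u v m))
     then int m else pick near far u v m)"

lemma pick_cases:
  "(pick near far u v m = - 1 \<and> (\<forall>i\<in>{0..<int m}. \<not> (0 < u i \<and> near i = v)))
   \<or> (pick near far u v m \<in> {0..<int m} \<and> 0 < u (pick near far u v m) \<and> near (pick near far u v m) = v
      \<and> (\<forall>i\<in>{0..<int m}. 0 < u i \<and> near i = v \<longrightarrow> far (pick near far u v m) \<le> far i))"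
proof (induction m)
  case 0
  then show ?case by simp
next
  case (Suc m)
  have *: "{0..<int (Suc m)} = insert (int m) {0..<int m}" by auto
  show ?case using Suc unfolding * by (auto; force)
qed

lemma pick_minimal:
  assumes "i \<in> {0..<n}" "0 < u i" "near i = v" and s: "s = pick near far u v (nat n)"
  shows "s \<in> {0..<n}" "0 < u s" "near s = v"
    "\<And>j. j \<in> {0..<n} \<Longrightarrow> 0 < u j \<Longrightarrow> near j = v \<Longrightarrow> far s \<le> far j"
  using pick_cases[of near far u v "nat n"] assms(1-3) unfolding s by auto

lemma pick_in_range: "0 \<le> pick near far u v (nat n) \<Longrightarrow> pick near far u v (nat n) \<in> {0..<n}"
  using pick_cases[of near far u v "nat n"] by (auto split: if_splits)

section \<open>Unary numbers in bit strings\<close>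

function ones :: "nat \<Rightarrow> nat" where
  "ones g = (if odd g then Suc (ones (g div 2)) else 0)"
  by pat_completeness auto
termination by (relation "measure id") (auto elim!: oddE)

text \<open>The terminating zero is removed as well. Since \<open>ones 0 = 0\<close> and
  \<open>drop_ones 0 = 0\<close>, a number acts as a bit string padded with zeros, and every number
  can be decoded.\<close>

function drop_ones :: "nat \<Rightarrow> nat" where
  "drop_ones g = (if odd g then drop_ones (g div 2) else g div 2)"
  by pat_completeness auto
termination by (relation "measure id") (auto elim!: oddE)

declare ones.simps [simp del] drop_ones.simps [simp del]

text \<open>
  Bit strings are read from the least significant end; a number \<open>a\<close> is written as \<open>a\<close> ones followed by a zero.
\<close>

primrec unary :: "nat \<Rightarrow> nat \<Rightarrow> nat" where
  "unary 0 r = 2 * r"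
| "unary (Suc a) r = Suc (2 * unary a r)"

lemma ones_unary [simp]: "ones (unary a r) = a"
  by (induction a) (simp_all add: ones.simps[of "2 * _"] ones.simps[of "Suc _"])

lemma drop_ones_unary [simp]: "drop_ones (unary a r) = r"
  by (induction a) (simp_all add: drop_ones.simps[of "2 * _"] drop_ones.simps[of "Suc _"])

lemma unary_less: "r < 2 ^ k \<Longrightarrow> unary a r < 2 ^ (k + a + 1)"
  by (induction a) auto

section \<open>The search as a recursion on a bit string, and its soundness\<close>

definition mark :: "(int \<Rightarrow> int) \<Rightarrow> int \<Rightarrow> int \<Rightarrow> int" where
  "mark u s = (if 0 \<le> s then u(s := 0) else u)"

text \<open>
  One run of the search, with all choices read off the bits of \<open>g\<close>. Sensors with \<open>u i \<le> 0\<close> are settled and \<open>b\<close> is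
  the remaining budget. For the leftmost gap, the bits give the side and the distance of the near end
  (which determine a class of unsettled sensors), whether the longest sensor of the class is settled
  without being moved, and sign and size of the displacement of the longest one still unsettled.
\<close>

function accept :: "int \<Rightarrow> int \<Rightarrow> (int \<Rightarrow> int) \<Rightarrow> (int \<Rightarrow> int) \<Rightarrow> (int \<Rightarrow> int) \<Rightarrow> int \<Rightarrow> nat \<Rightarrow> bool" where
  "accept n L l e u b g =
    (if b < 0 then False else if L \<le> first_gap n l e then True else
      (let right = odd g;
           g1 = g div 2;
           v = (if right then - 1 - first_gap n l e else first_gap n l e) - int (ones g1);
           g2 = drop_ones g1;
           p = (\<lambda>u. pick (near_end right l e) (far_end right l e) u v (nat n));
           u1 = (if odd g2 then mark u (p u) else u);
           s = p u1;
           g3 = g2 div 2;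
           g4 = g3 div 2;
           m = 1 + int (ones g4);
           d = (if odd g3 then - m else m)
       in 0 \<le> s \<and> accept n L (l(s := l s + d)) (e(s := e s + d)) (mark u1 s) (b - m) (drop_ones g4)))"
  by pat_completeness auto
termination by (relation "measure (\<lambda>(n, L, l, e, u, b, g). nat (b + 1))") auto

declare accept.simps [simp del]

lemma accept_no_budget: "b < 0 \<Longrightarrow> \<not> accept n L l e u b g"
  by (simp add: accept.simps)

lemma accept_covered: "0 \<le> b \<Longrightarrow> L \<le> first_gap n l e \<Longrightarrow> accept n L l e u b g"
  by (simp add: accept.simps)

text \<open>Triangle inequality: the rest of a run may move the same sensor again.\<close>

lemma sum_abs_shift_le:
  fixes \<delta> :: "int \<Rightarrow> int"
  assumes "s \<in> {0..<n}"
  shows "(\<Sum>i\<in>{0..<n}. \<bar>(\<delta>(s := \<delta> s + d)) i\<bar>) \<le> (\<Sum>i\<in>{0..<n}. \<bar>\<delta> i\<bar>) + \<bar>d\<bar>"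
  using assms by (simp add: sum.remove[of "{0..<n}" s])

text \<open>An accepted run is a list of moves of existing sensors whose total cost fits the budget,
  however the bits selected them. Adding up the moves of each sensor gives
  \<open>\<delta>\<close>.\<close>

lemma accept_sound:
  assumes "0 \<le> L" "accept n L l e u b g"
  shows "\<exists>\<delta>. (\<Sum>i\<in>{0..<n}. \<bar>\<delta> i\<bar>) \<le> b \<and> covers n L (\<lambda>i. l i + \<delta> i) (\<lambda>i. e i + \<delta> i)"
  using assms(2)
proof (induction "nat b" arbitrary: l e u b g rule: less_induct)
  case less
  have b: "0 \<le> b" using less.prems accept_no_budget not_less by blast
  show ?case
  proof (cases "L \<le> first_gap n l e")
    case True
    then show ?thesis using b assms(1) covers_iff_first_gap[of L n l e]
      by (intro exI[of _ "\<lambda>_. 0"]) auto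
  next
    case False
    obtain near far u1 u2 v s d m g' where s: "s = pick near far u1 v (nat n)" "0 \<le> s"
      and acc: "accept n L (l(s := l s + d)) (e(s := e s + d)) u2 (b - m) g'"
      and m: "m \<ge> 1" "\<bar>d\<bar> = m"
    proof -
      have "\<not> b < 0" using b by simp
      then show ?thesis using less.prems False unfolding accept.simps[of n L l e u b g] Let_def
        apply (simp only: if_False)
        apply (elim conjE)
        apply (rule that[OF refl], assumption, assumption)
         apply auto
        done
    qed
    have sn: "s \<in> {0..<n}" using s pick_in_range by blast
    have "0 \<le> b - m" using acc accept_no_budget not_less by blast
    then have "nat (b - m) < nat b" using m by linarith
    from less.hyps[OF this acc] obtain \<delta> where
      \<delta>: "(\<Sum>i\<in>{0..<n}. \<bar>\<delta> i\<bar>) \<le> b - m"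
        "covers n L (\<lambda>i. (l(s := l s + d)) i + \<delta> i) (\<lambda>i. (e(s := e s + d)) i + \<delta> i)" by blast
    have eq: "(\<lambda>i. (f(s := f s + d)) i + \<delta> i) = (\<lambda>i. f i + (\<delta>(s := \<delta> s + d)) i)" for f :: "int \<Rightarrow> int"
      by auto
    show ?thesis using \<delta> sum_abs_shift_le[OF sn, of \<delta> d] m unfolding eq
      by (intro exI[of _ "\<delta>(s := \<delta> s + d)"]) auto
  qed
qed

section \<open>Completeness by exchange\<close>

lemma far_end_dominates:
  assumes "near_end right l e s = near_end right l e i" "far_end right l e s \<le> far_end right l e i"
    and "l i + t \<le> k" "k < e i + t"
  shows "l s + t \<le> k" "k < e s + t"
  \<comment> \<open>With equal near ends, a smaller far end means that \<open>s\<close> contains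
    \<open>i\<close>, and equal shifts preserve this.\<close>
  using assms by (auto simp: near_end_def far_end_def split: if_splits)

text \<open>The share of \<open>s\<close> in a solution can be carried out first: what remains is
  the same solution with \<open>s\<close> at rest, and it never needs \<open>s\<close>
  again.\<close>

lemma solvable_move:
  assumes \<delta>: "(\<Sum>i\<in>{0..<n}. \<bar>\<delta> i\<bar>) \<le> b" "\<And>i. i \<in> {0..<n} \<Longrightarrow> u i \<le> 0 \<Longrightarrow> \<delta> i = 0"
      "covers n L (\<lambda>i. l i + \<delta> i) (\<lambda>i. e i + \<delta> i)"
    and s: "s \<in> {0..<n}"
  shows "solvable n L (l(s := l s + \<delta> s)) (e(s := e s + \<delta> s)) (mark u s) (b - \<bar>\<delta> s\<bar>)"
  unfolding solvable_def
proof (intro exI[of _ "\<delta>(s := 0)"] conjI ballI impI)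
  show "(\<Sum>i\<in>{0..<n}. \<bar>(\<delta>(s := 0)) i\<bar>) \<le> b - \<bar>\<delta> s\<bar>"
    using \<delta>(1) s by (simp add: sum.remove[of "{0..<n}" s])
  show "(\<delta>(s := 0)) i = 0" if "i \<in> {0..<n}" "mark u s i \<le> 0" for i
    using that \<delta>(2) by (auto simp: mark_def split: if_splits)
  have "(\<lambda>i. (f(s := f s + \<delta> s)) i + (\<delta>(s := 0)) i) = (\<lambda>i. f i + \<delta> i)" for f :: "int \<Rightarrow> int"
    by auto
  then show "covers n L (\<lambda>i. (l(s := l s + \<delta> s)) i + (\<delta>(s := 0)) i) (\<lambda>i. (e(s := e s + \<delta> s)) i + (\<delta>(s := 0)) i)"
    using \<delta>(3) by simp
qed

text \<open>
  Let \<open>s\<close> be the longest unsettled sensor of the class of a sensor \<open>i\<close> that covers the gap in a solution. If \<open>s\<close> does not move,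
  it makes an unmoved second longest sensor \<open>s2\<close> redundant, so \<open>s2\<close> can take over the move of \<open>i\<close>.
\<close>

lemma solvable_step:
  assumes sol: "solvable n L l e u b" and gap: "first_gap n l e < L"
  obtains right a fx u1 s d where "int a < b"
    "u1 = (if fx then mark u (pick (near_end right l e) (far_end right l e) u
         ((if right then - 1 - first_gap n l e else first_gap n l e) - int a) (nat n)) else u)"
    "s = pick (near_end right l e) (far_end right l e) u1
         ((if right then - 1 - first_gap n l e else first_gap n l e) - int a) (nat n)"
    "0 \<le> s" "d \<noteq> 0" "\<bar>d\<bar> \<le> b"
    "solvable n L (l(s := l s + d)) (e(s := e s + d)) (mark u1 s) (b - \<bar>d\<bar>)"
proof -
  define c where "c = first_gap n l e"
  from sol obtain \<delta> where
    \<delta>: "(\<Sum>i\<in>{0..<n}. \<bar>\<delta> i\<bar>) \<le> b" "\<And>i. i \<in> {0..<n} \<Longrightarrow> u i \<le> 0 \<Longrightarrow> \<delta> i = 0"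
      "covers n L (\<lambda>i. l i + \<delta> i) (\<lambda>i. e i + \<delta> i)"
    unfolding solvable_def by blast
  have le_b: "\<bar>\<delta> i\<bar> \<le> b" if "i \<in> {0..<n}" for i
    using member_le_sum[of i "{0..<n}" "\<lambda>i. \<bar>\<delta> i\<bar>"] that \<delta>(1) by auto
  obtain i where i: "i \<in> {0..<n}" "l i + \<delta> i \<le> c" "c < e i + \<delta> i"
    using \<delta>(3) gap first_gap_nonneg[of n l e] unfolding covers_def c_def by blast
  have nc: "\<not> (l i \<le> c \<and> c < e i)" using first_gap_uncovered[of n l e] i(1) unfolding c_def by blast
  then have di: "\<delta> i \<noteq> 0" using i by auto
  then have ui: "0 < u i" using \<delta>(2) i(1) by force
  \<comment> \<open>Before its move, \<open>i\<close> misses the cell \<open>c\<close>, so it lies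
    entirely on one side of it.\<close>
  define right where "right = (c < l i)"
  define near where "near = near_end right l e"
  define far where "far = far_end right l e"
  define a where "a = nat ((if right then - 1 - c else c) - near i)"
  define v where "v = (if right then - 1 - c else c) - int a"
  \<comment> \<open>To cover the cell, the near end must pass the gap in between and the cell
    itself, which has length 1. This makes the second bound strict and leaves at most
    \<open>b\<close> distances on each side.\<close>
  have a: "0 \<le> (if right then - 1 - c else c) - near i" "(if right then - 1 - c else c) - near i < b"
    using nc i(2,3) le_b[OF i(1)] unfolding near_def near_end_def right_def by (auto split: if_splits)
  then have v: "near i = v" and ab: "int a < b" unfolding v_def a_def by auto
  define s where "s = pick near far u v (nat n)"
  note s = pick_minimal[of i n u near v s far, OF i(1) ui v s_def]
  show thesis
  proof (cases "\<delta> s = 0")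
    case False
    show thesis
      by (rule that[of a u False right s "\<delta> s"])
        (use ab False s(1) le_b solvable_move[OF \<delta> s(1)] s_def in
          \<open>simp_all add: near_def far_def v_def c_def\<close>)
  next
    case True
    define u1 where "u1 = mark u s"
    define s2 where "s2 = pick near far u1 v (nat n)"
    have i_neq_s: "i \<noteq> s" using True di by auto
    have u1: "u1 = u(s := 0)" using s(1) unfolding u1_def mark_def by auto
    have ui1: "0 < u1 i" using ui i_neq_s u1 by simp
    note s2 = pick_minimal[of i n u1 near v s2 far, OF i(1) ui1 v s2_def]
    have ss2: "s2 \<noteq> s" using s2(2) u1 by auto
    have dom1: "far s \<le> far s2" using s(4)[OF s2(1)] s2(2,3) ss2 u1 by auto
    have dom2: "far s2 \<le> far i" using s2(4)[OF i(1) ui1 v] .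
    show thesis
    proof (cases "\<delta> s2 = 0")
      case False
      have \<delta>': "\<delta> j = 0" if "j \<in> {0..<n}" "u1 j \<le> 0" for j
        using that \<delta>(2) True unfolding u1 by (auto split: if_splits)
      show thesis
        by (rule that[of a u1 True right s2 "\<delta> s2"])
          (use ab False s2(1) le_b solvable_move[OF \<delta>(1) \<delta>' \<delta>(3) s2(1)] s_def s2_def u1_def in
            \<open>simp_all add: near_def far_def v_def c_def\<close>)
    next
      case s20: True
      define \<delta>2 where "\<delta>2 = \<delta>(i := 0, s2 := \<delta> i)"
      have is2: "i \<noteq> s2" using s20 di by auto
      have sum: "(\<Sum>j\<in>{0..<n}. \<bar>\<delta>2 j\<bar>) \<le> b"
      proof -
        have "(\<Sum>j\<in>{0..<n}. \<bar>f j\<bar>) = \<bar>f i\<bar> + (\<bar>f s2\<bar> + (\<Sum>j\<in>{0..<n} - {i} - {s2}. \<bar>f j\<bar>))" for f :: "int \<Rightarrow> int"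
          using i(1) s2(1) is2 by (subst sum.remove[of _ i], simp, simp, subst sum.remove[of _ s2]) auto
        from this[of \<delta>2] this[of \<delta>] have "(\<Sum>j\<in>{0..<n}. \<bar>\<delta>2 j\<bar>) = (\<Sum>j\<in>{0..<n}. \<bar>\<delta> j\<bar>)"
          unfolding \<delta>2_def using is2 s20 by simp
        then show ?thesis using \<delta>(1) by simp
      qed
      have \<delta>2u: "\<delta>2 j = 0" if "j \<in> {0..<n}" "u1 j \<le> 0" for j
        using that \<delta>(2) True s2(2) ss2 i_neq_s unfolding u1 \<delta>2_def by (auto split: if_splits)
      have cov: "covers n L (\<lambda>j. l j + \<delta>2 j) (\<lambda>j. e j + \<delta>2 j)"
        unfolding covers_def
      proof (intro allI impI)
        fix k assume "0 \<le> k \<and> k < L"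
        then obtain j where j: "j \<in> {0..<n}" "l j + \<delta> j \<le> k" "k < e j + \<delta> j"
          using \<delta>(3) unfolding covers_def by blast
        consider "j = i" | "j = s2" | "j \<noteq> i" "j \<noteq> s2" by blast
        then show "\<exists>j\<in>{0..<n}. l j + \<delta>2 j \<le> k \<and> k < e j + \<delta>2 j"
        proof cases
          case 1
          then show ?thesis
            using far_end_dominates[of right l e s2 i "\<delta> i" k] j s2(1,3) v dom2
            by (intro bexI[of _ s2]) (auto simp: \<delta>2_def near_def far_def)
        next
          case 2
          then show ?thesis
            using far_end_dominates[of right l e s s2 0 k] j s(1,3) s2(3) dom1 True s20 i_neq_s ss2
            by (intro bexI[of _ s]) (auto simp: \<delta>2_def near_def far_def)
        next
          case 3
          then show ?thesis using j by (intro bexI[of _ j]) (auto simp: \<delta>2_def)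
        qed
      qed
      have d2: "\<delta>2 s2 = \<delta> i" by (simp add: \<delta>2_def)
      show thesis
        by (rule that[of a u1 True right s2 "\<delta> i"])
          (use ab di i(1) s2(1) le_b solvable_move[OF sum \<delta>2u cov s2(1)] s_def s2_def u1_def d2 in
            \<open>simp_all add: near_def far_def v_def c_def\<close>)
    qed
  qed
qed

lemma accept_complete:
  assumes "solvable n L l e u b" "0 \<le> b" "b \<le> int B"
  shows "\<exists>g < 2 ^ (nat b * (2 * B + 3)). accept n L l e u b g"
  using assms
proof (induction "nat b" arbitrary: l e u b rule: less_induct)
  case less
  show ?case
  proof (cases "L \<le> first_gap n l e")
    case True
    then show ?thesis using less.prems by (intro exI[of _ 0]) (simp add: accept_covered)
  next
    case False
    then obtain right a fx u1 s d where st: "int a < b"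
      "u1 = (if fx then mark u (pick (near_end right l e) (far_end right l e) u
         ((if right then - 1 - first_gap n l e else first_gap n l e) - int a) (nat n)) else u)"
      "s = pick (near_end right l e) (far_end right l e) u1
         ((if right then - 1 - first_gap n l e else first_gap n l e) - int a) (nat n)"
      "0 \<le> s" "d \<noteq> 0" "\<bar>d\<bar> \<le> b"
      "solvable n L (l(s := l s + d)) (e(s := e s + d)) (mark u1 s) (b - \<bar>d\<bar>)"
      using solvable_step[OF less.prems(1)] by (metis linorder_not_le)
    have "nat (b - \<bar>d\<bar>) < nat b" "0 \<le> b - \<bar>d\<bar>" "b - \<bar>d\<bar> \<le> int B" using st(5,6) less.prems by auto
    from less.hyps[OF this(1) st(7) this(2,3)] obtain g' where
      g': "g' < 2 ^ (nat (b - \<bar>d\<bar>) * (2 * B + 3))"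
      "accept n L (l(s := l s + d)) (e(s := e s + d)) (mark u1 s) (b - \<bar>d\<bar>) g'" by blast
    \<comment> \<open>Displacements are nonzero, so one less than the size is encoded.\<close>
    define k where "k = nat (\<bar>d\<bar> - 1)"
    have k: "1 + int k = \<bar>d\<bar>" unfolding k_def using st(5) by auto
    \<comment> \<open>The fields are assembled in reverse order of reading, the last one
      innermost.\<close>
    define g3 where "g3 = 2 * unary k g' + of_bool (d < 0)"
    define g1 where "g1 = unary a (2 * g3 + of_bool fx)"
    define g where "g = 2 * g1 + of_bool right"
    have dec: "odd g = right" "g div 2 = g1" "ones g1 = a" "odd (drop_ones g1) = fx"
      "drop_ones g1 div 2 = g3" "odd g3 = (d < 0)" "ones (g3 div 2) = k" "drop_ones (g3 div 2) = g'"
      unfolding g_def g1_def g3_def by auto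
    have dd: "(if d < 0 then - \<bar>d\<bar> else \<bar>d\<bar>) = d" by auto
    have "accept n L l e u b g"
      unfolding accept.simps[of n L l e u b g] Let_def dec k dd
      using st(4) g'(2) False less.prems(2) unfolding st(2)[symmetric] st(3)[symmetric] by simp
    moreover have "g < 2 ^ (nat b * (2 * B + 3))"
    proof -
      define q where "q = nat (b - \<bar>d\<bar>) * (2 * B + 3)"
      have dbl: "2 * x + of_bool P < 2 ^ Suc j" if "x < 2 ^ j" for x j :: nat and P
        using that by (cases P) auto
      have "g < 2 ^ Suc (Suc (Suc (q + k + 1)) + a + 1)"
        unfolding g_def g1_def g3_def by (intro dbl unary_less) (use g' in \<open>simp add: q_def\<close>)
      also have "\<dots> \<le> 2 ^ (nat b * (2 * B + 3))"
      proof (rule power_increasing)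
        have "Suc (nat (b - \<bar>d\<bar>)) \<le> nat b" using st(5,6) by auto
        then have "Suc (nat (b - \<bar>d\<bar>)) * (2 * B + 3) \<le> nat b * (2 * B + 3)" by (rule mult_le_mono1)
        \<comment> \<open>Together these give
          \<open>1 + (a + 1) + 1 + 1 + (k + 1) \<le> 2 * B + 3\<close> for the bits used by this
          move.\<close>
        moreover have "a < B" "k < B" using st(1,5,6) k less.prems by auto
        ultimately show "Suc (Suc (Suc (q + k + 1)) + a + 1) \<le> nat b * (2 * B + 3)"
          unfolding q_def by simp
      qed simp
      finally show ?thesis .
    qed
    ultimately show ?thesis by blast
  qed
qed

text \<open>Soundness yields an unrestricted displacement, which qualifies because no sensor is
  settled at the start.\<close>

lemma solvable_iff_accept:
  assumes "0 \<le> L" "\<And>i. i \<in> {0..<n} \<Longrightarrow> 0 < u i"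
  shows "solvable n L l e u (int B) \<longleftrightarrow> (\<exists>g < 2 ^ (B * (2 * B + 3)). accept n L l e u (int B) g)"
proof
  assume "solvable n L l e u (int B)"
  then show "\<exists>g < 2 ^ (B * (2 * B + 3)). accept n L l e u (int B) g"
    using accept_complete[of n L l e u "int B" B] by simp
next
  assume "\<exists>g < 2 ^ (B * (2 * B + 3)). accept n L l e u (int B) g"
  then show "solvable n L l e u (int B)"
    using accept_sound[OF assms(1)] assms(2) unfolding solvable_def by (meson linorder_not_le)
qed

lemma first_gap_cong:
  assumes "\<And>i. i \<in> {0..<n} \<Longrightarrow> l i = l' i" "\<And>i. i \<in> {0..<n} \<Longrightarrow> e i = e' i"
  shows "first_gap n l e = first_gap n l' e'"
proof -
  have "(\<exists>i\<in>{0..<n}. l i \<le> k \<and> k < e i) \<longleftrightarrow> (\<exists>i\<in>{0..<n}. l' i \<le> k \<and> k < e' i)" for k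
    using assms by auto
  then show ?thesis unfolding first_gap_def by simp
qed

lemma pick_cong:
  assumes "\<And>i. i \<in> {0..<int m} \<Longrightarrow> near i = near' i \<and> far i = far' i \<and> u i = u' i"
  shows "pick near far u v m = pick near' far' u' v m"
  using assms
proof (induction m)
  case 0
  then show ?case by simp
next
  case (Suc m)
  then have "pick near far u v m = pick near' far' u' v m" by simp
  moreover have "0 \<le> pick near' far' u' v m \<Longrightarrow>
      far (pick near' far' u' v m) = far' (pick near' far' u' v m)"
    using pick_in_range[of near' far' u' v "int m"] Suc.prems by simp
  ultimately show ?case using Suc.prems[of "int m"] by (auto simp: not_less)
qed

text \<open>The arrays in memory agree with the mathematical ones only on the indices below
  \<open>n\<close>; elsewhere \<open>arr\<close> reads unrelated cells.\<close>

lemma accept_cong: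
  assumes "\<And>i. i \<in> {0..<n} \<Longrightarrow> l i = l' i" "\<And>i. i \<in> {0..<n} \<Longrightarrow> e i = e' i"
    "\<And>i. i \<in> {0..<n} \<Longrightarrow> u i = u' i"
  shows "accept n L l e u b g = accept n L l' e' u' b g"
  using assms
proof (induction "nat (b + 1)" arbitrary: l e u l' e' u' b g rule: less_induct)
  case less
  have gap: "first_gap n l e = first_gap n l' e'"
    by (rule first_gap_cong) (use less.prems in auto)
  define v where "v = (if odd g then - 1 - first_gap n l e else first_gap n l e) - int (ones (g div 2))"
  define p where "p = (\<lambda>u. pick (near_end (odd g) l e) (far_end (odd g) l e) u v (nat n))"
  define p' where "p' = (\<lambda>u. pick (near_end (odd g) l' e') (far_end (odd g) l' e') u v (nat n))"
  define g2 where "g2 = drop_ones (g div 2)"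
  define u1 where "u1 = (if odd g2 then mark u (p u) else u)"
  define u1' where "u1' = (if odd g2 then mark u' (p' u') else u')"
  define g3 where "g3 = g2 div 2"
  define m where "m = 1 + int (ones (g3 div 2))"
  define d where "d = (if odd g3 then - m else m)"
  have pp: "p w = p' w'" if "\<And>i. i \<in> {0..<n} \<Longrightarrow> w i = w' i" for w w'
    unfolding p_def p'_def by (rule pick_cong) (use that less.prems in \<open>auto simp: near_end_def far_end_def split: if_splits\<close>)
  have u1: "u1 i = u1' i" if "i \<in> {0..<n}" for i
    using that pp[of u u', OF less.prems(3)] less.prems(3) unfolding u1_def u1'_def mark_def by auto
  have s: "p u1 = p' u1'" by (rule pp) (rule u1)
  have rng: "0 \<le> p u1 \<Longrightarrow> p u1 \<in> {0..<n}" unfolding p_def by (rule pick_in_range)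
  have "accept n L (l(p u1 := l (p u1) + d)) (e(p u1 := e (p u1) + d)) (mark u1 (p u1)) (b - m) (drop_ones (g3 div 2))
    = accept n L (l'(p u1 := l' (p u1) + d)) (e'(p u1 := e' (p u1) + d)) (mark u1' (p u1)) (b - m) (drop_ones (g3 div 2))"
    if "0 \<le> b" "0 \<le> p u1"
    by (rule less.hyps) (use that rng less.prems u1 in \<open>auto simp: m_def mark_def\<close>)
  moreover have "accept n L l e u b g \<longleftrightarrow> 0 \<le> b \<and> (L \<le> first_gap n l e \<or> 0 \<le> p u1 \<and>
      accept n L (l(p u1 := l (p u1) + d)) (e(p u1 := e (p u1) + d)) (mark u1 (p u1)) (b - m) (drop_ones (g3 div 2)))"
    unfolding accept.simps[of n L l e u b g] Let_def p_def u1_def d_def m_def g3_def g2_def v_def by simp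
  moreover have "accept n L l' e' u' b g \<longleftrightarrow> 0 \<le> b \<and> (L \<le> first_gap n l' e' \<or> 0 \<le> p' u1' \<and>
      accept n L (l'(p' u1' := l' (p' u1') + d)) (e'(p' u1' := e' (p' u1') + d)) (mark u1' (p' u1')) (b - m) (drop_ones (g3 div 2)))"
    unfolding accept.simps[of n L l' e' u' b g] Let_def p'_def u1'_def d_def m_def g3_def g2_def v_def gap by simp
  ultimately show ?case unfolding gap s by blast
qed

section \<open>Timed weakest preconditions\<close>

text \<open>The postcondition receives the exact time, so one judgement carries termination, result
  and running time.\<close>

definition wp :: "com \<Rightarrow> state \<Rightarrow> (nat \<Rightarrow> state \<Rightarrow> bool) \<Rightarrow> bool" where
  "wp c s Q \<longleftrightarrow> (\<exists>t s'. big_step c s t s' \<and> Q t s')"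

inductive_cases SkipE: "big_step Skip s t s'"
inductive_cases AssignE: "big_step (Assign r a) s t s'"
inductive_cases StoreE: "big_step (Store a b) s t s'"
inductive_cases SeqE: "big_step (Seq c1 c2) s t s'"
inductive_cases IfE: "big_step (If b c1 c2) s t s'"

lemma wp_Skip [simp]: "wp Skip s Q \<longleftrightarrow> Q 1 s"
  unfolding wp_def by (metis SkipE big_step.Skip)

lemma wp_Assign [simp]: "wp (Assign r a) s Q \<longleftrightarrow> Q 1 ((fst s)(r := aval a s), snd s)"
  unfolding wp_def by (metis AssignE big_step.Assign)

lemma wp_Store [simp]: "wp (Store a b) s Q \<longleftrightarrow> Q 1 (fst s, (snd s)(aval a s := aval b s))"
  unfolding wp_def by (metis StoreE big_step.Store)

lemma wp_Seq [simp]: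
  "wp (Seq c1 c2) s Q \<longleftrightarrow> wp c1 s (\<lambda>t1 s1. wp c2 s1 (\<lambda>t2. Q (t1 + t2)))"
  unfolding wp_def by (blast intro: big_step.Seq elim: SeqE)

lemma wp_If [simp]:
  "wp (If b c1 c2) s Q \<longleftrightarrow> (if bval b s then wp c1 s (\<lambda>t. Q (Suc t)) else wp c2 s (\<lambda>t. Q (Suc t)))"
  unfolding wp_def by (auto intro: big_step.IfT big_step.IfF elim!: IfE)

lemma wp_mono: "wp c s P \<Longrightarrow> (\<And>t s'. P t s' \<Longrightarrow> Q t s') \<Longrightarrow> wp c s Q"
  unfolding wp_def by blast

text \<open>Each round costs at most \<open>T\<close> and one unit for the test, and lowers
  \<open>m\<close>; the leading 1 is the final failing test.\<close>

lemma wp_While_measure: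
  assumes step: "\<And>s. I s \<Longrightarrow> bval b s \<Longrightarrow> wp c s (\<lambda>t s'. t \<le> T \<and> I s' \<and> m s' < m s)"
    and "I s"
  shows "wp (While b c) s (\<lambda>t s'. t \<le> 1 + m s * (T + 1) \<and> I s' \<and> \<not> bval b s')"
  using \<open>I s\<close>
proof (induction "m s" arbitrary: s rule: less_induct)
  case less
  show ?case
  proof (cases "bval b s")
    case False
    then have "big_step (While b c) s 1 s" by (rule big_step.WhileF)
    then show ?thesis unfolding wp_def using False less.prems by (intro exI[of _ 1] exI[of _ s]) simp
  next
    case True
    from step[OF less.prems True] obtain t1 s1 where
      1: "big_step c s t1 s1" "t1 \<le> T" "I s1" "m s1 < m s" unfolding wp_def by blast
    from less.hyps[OF 1(4,3)] obtain t2 s2 where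
      2: "big_step (While b c) s1 t2 s2" "t2 \<le> 1 + m s1 * (T + 1)" "I s2" "\<not> bval b s2"
      unfolding wp_def by blast
    have "Suc (m s1) * (T + 1) \<le> m s * (T + 1)" using 1(4) by (intro mult_le_mono1) simp
    then have "Suc (t1 + t2) \<le> 1 + m s * (T + 1)" using 1(2) 2(2) by simp
    then show ?thesis unfolding wp_def using big_step.WhileT[OF True 1(1) 2(1)] 2(3,4) by blast
  qed
qed

lemma wp_While:
  assumes "I s"
    and "\<And>s. I s \<Longrightarrow> bval b s \<Longrightarrow> wp c s (\<lambda>t s'. t \<le> T \<and> I s' \<and> m s' < m s)"
    and "\<And>t s'. t \<le> 1 + m s * (T + 1) \<Longrightarrow> I s' \<Longrightarrow> \<not> bval b s' \<Longrightarrow> Q t s'"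
  shows "wp (While b c) s Q"
  by (rule wp_mono[OF wp_While_measure[where I = I and m = m and T = T]]) (use assms in auto)

section \<open>Derived tests and memory layout\<close>

definition Eq :: "aexp \<Rightarrow> aexp \<Rightarrow> bexp" where
  "Eq a b = And (Not (Less a b)) (Not (Less b a))"

definition Or :: "bexp \<Rightarrow> bexp \<Rightarrow> bexp" where
  "Or b c = Not (And (Not b) (Not c))"

lemma bval_Eq_Or [simp]:
  "bval (Eq a b) s \<longleftrightarrow> aval a s = aval b s" "bval (Or p q) s \<longleftrightarrow> bval p s \<or> bval q s"
  by (auto simp: Eq_def Or_def)

abbreviation seq (infixr ";;" 60) where "c1 ;; c2 \<equiv> Seq c1 c2"

text \<open>
  Three arrays, for left ends, right ends and settled flags, are interleaved on the negative addresses,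
  which the input does not use.
\<close>

definition loc :: "int \<Rightarrow> int \<Rightarrow> int" where
  "loc k i = - k - (i + (i + i))"

definition adr :: "int \<Rightarrow> nat \<Rightarrow> aexp" where
  "adr k r = Minus (N (- k)) (Plus (Reg r) (Plus (Reg r) (Reg r)))"

definition arr :: "int \<Rightarrow> (int \<Rightarrow> int) \<Rightarrow> int \<Rightarrow> int" where
  "arr k M i = M (loc k i)"

lemma aval_adr [simp]: "aval (adr k r) s = loc k (fst s r)"
  by (simp add: adr_def loc_def)

text \<open>Addresses \<open>loc k i\<close> are congruent to \<open>- k\<close> modulo 3, so the
  three arrays never overlap, and each \<open>loc k\<close> is injective.\<close>

lemma arr_update [simp]:
  "arr k (M(loc k i := x)) = (arr k M)(i := x)"
  "arr 1 (M(loc 2 i := x)) = arr 1 M" "arr 1 (M(loc 3 i := x)) = arr 1 M"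
  "arr 2 (M(loc 1 i := x)) = arr 2 M" "arr 2 (M(loc 3 i := x)) = arr 2 M"
  "arr 3 (M(loc 1 i := x)) = arr 3 M" "arr 3 (M(loc 2 i := x)) = arr 3 M"
  unfolding arr_def loc_def fun_eq_iff fun_upd_apply by (auto; presburger)+

lemma loc_negative: "0 \<le> i \<Longrightarrow> 0 < k \<Longrightarrow> loc k i < 0"
  by (simp add: loc_def)

lemma aval_Load_adr [simp]: "aval (Load (adr k r)) s = arr k (snd s) (fst s r)"
  by (simp add: arr_def)

declare aval.simps(3) [simp del]

text \<open>
  \<open>rZ\<close> is the correction for \<open>L = 0\<close>, \<open>rCnt\<close> runs through all bit strings below \<open>rLim\<close>, and \<open>rG\<close> holds the unread bits.
\<close>

abbreviation (input) "rAns \<equiv> 0::nat"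
abbreviation (input) "rN \<equiv> 19::nat"
abbreviation (input) "rL \<equiv> 2::nat"
abbreviation (input) "rB \<equiv> 3::nat"
abbreviation (input) "rZ \<equiv> 4::nat"
abbreviation (input) "rLim \<equiv> 5::nat"
abbreviation (input) "rCnt \<equiv> 6::nat"
abbreviation (input) "rG \<equiv> 7::nat"
abbreviation (input) "rb \<equiv> 8::nat"
abbreviation (input) "rc \<equiv> 9::nat"
abbreviation (input) "ri \<equiv> 10::nat"
abbreviation (input) "rs \<equiv> 11::nat"
abbreviation (input) "rRight \<equiv> 12::nat"
abbreviation (input) "ra \<equiv> 13::nat"
abbreviation (input) "rv \<equiv> 14::nat"
abbreviation (input) "rNear \<equiv> 15::nat"
abbreviation (input) "rFar \<equiv> 16::nat"
abbreviation (input) "rBest \<equiv> 17::nat"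
abbreviation (input) "rd \<equiv> 18::nat"

definition OddG :: bexp where
  "OddG = Less (Plus (Half (Reg rG)) (Half (Reg rG))) (Reg rG)"

lemma bval_OddG [simp]: "fst s rG = int g \<Longrightarrow> bval OddG s \<longleftrightarrow> odd g"
  unfolding OddG_def by simp presburger

section \<open>The program\<close>

text \<open>A covered candidate jumps to the right end of the covering sensor, and the scan restarts
  because sensors already passed may cover the new candidate.\<close>

definition Gap :: com where
  "Gap = Assign rc (N 0) ;; Assign ri (N 0) ;;
    While (Less (Reg ri) (Reg rN))
      (If (And (Not (Less (Reg rc) (Load (adr 1 ri)))) (Less (Reg rc) (Load (adr 2 ri))))
        (Assign rc (Load (adr 2 ri)) ;; Assign ri (N 0))
        (Assign ri (Plus (Reg ri) (N 1))))"

lemma wp_Gap: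
  assumes n: "fst s rN = int n"
  shows "wp Gap s (\<lambda>t s'. t \<le> 6 * (n + 1)\<^sup>2 \<and> snd s' = snd s \<and>
    (\<forall>r. r \<notin> {rc, ri} \<longrightarrow> fst s' r = fst s r) \<and>
    fst s' rc = first_gap (int n) (arr 1 (snd s)) (arr 2 (snd s)))"
proof -
  define l e where "l = arr 1 (snd s)" and "e = arr 2 (snd s)"
  define I where "I s' \<longleftrightarrow> snd s' = snd s \<and> (\<forall>r. r \<notin> {rc, ri} \<longrightarrow> fst s' r = fst s r) \<and>
     0 \<le> fst s' rc \<and> covers (int n) (fst s' rc) l e \<and> 0 \<le> fst s' ri \<and> fst s' ri \<le> int n \<and>
     (\<forall>j\<in>{0..<fst s' ri}. \<not> (l j \<le> fst s' rc \<and> fst s' rc < e j))" for s' :: state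
  \<comment> \<open>A lexicographic measure: a jump lowers the number of sensors ending beyond
    \<open>rc\<close>, and the weight \<open>n + 1\<close> outweighs the restarted scan.\<close>
  define m where "m s' = card ({0..<int n} \<inter> {j. fst s' rc < e j}) * (n + 1) + nat (int n - fst s' ri)"
    for s' :: state
  have step: "wp (If (And (Not (Less (Reg rc) (Load (adr 1 ri)))) (Less (Reg rc) (Load (adr 2 ri))))
        (Assign rc (Load (adr 2 ri)) ;; Assign ri (N 0))
        (Assign ri (Plus (Reg ri) (N 1)))) s' (\<lambda>t s''. t \<le> 3 \<and> I s'' \<and> m s'' < m s')"
    if I: "I s'" and b: "bval (Less (Reg ri) (Reg rN)) s'" for s'
  proof -
    define c i where "c = fst s' rc" and "i = fst s' ri"
    have mem: "snd s' = snd s" and i: "0 \<le> i" "i < int n" and c: "0 \<le> c" "covers (int n) c l e"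
      using I b n unfolding I_def c_def i_def by auto
    show ?thesis
    proof (cases "l i \<le> c \<and> c < e i")
      case True
      have "covers (int n) (e i) l e"
        unfolding covers_def
      proof (intro allI impI)
        fix k assume k: "0 \<le> k \<and> k < e i"
        show "\<exists>j\<in>{0..<int n}. l j \<le> k \<and> k < e j"
        proof (cases "k < c")
          case True
          then show ?thesis using c k unfolding covers_def by blast
        next
          case False
          then show ?thesis using True k i by (intro bexI[of _ i]) auto
        qed
      qed
      then have "I ((fst s')(rc := e i, ri := 0), snd s')"
        using I True c unfolding I_def by auto
      moreover have "m ((fst s')(rc := e i, ri := 0), snd s') < m s'"
      proof -
        have "card ({0..<int n} \<inter> {j. e i < e j}) < card ({0..<int n} \<inter> {j. c < e j})"
        proof (rule psubset_card_mono)
          have "i \<in> {0..<int n} \<inter> {j. c < e j}" "i \<notin> {0..<int n} \<inter> {j. e i < e j}"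
            using True i by simp_all
          moreover have "{0..<int n} \<inter> {j. e i < e j} \<subseteq> {0..<int n} \<inter> {j. c < e j}"
            using True by (intro Int_mono Collect_mono) auto
          ultimately show "{0..<int n} \<inter> {j. e i < e j} \<subset> {0..<int n} \<inter> {j. c < e j}" by blast
        qed simp
        then have "Suc (card ({0..<int n} \<inter> {j. e i < e j})) * (n + 1) \<le> card ({0..<int n} \<inter> {j. c < e j}) * (n + 1)"
          by (intro mult_le_mono1) simp
        then show ?thesis using i unfolding m_def c_def i_def by simp
      qed
      ultimately show ?thesis
        using True mem unfolding c_def i_def l_def e_def by simp
    next
      case False
      have "{0..<i + 1} = insert i {0..<i}" using i by auto
      then have "I ((fst s')(ri := i + 1), snd s')"
        using I False i unfolding I_def c_def i_def by auto
      moreover have "m ((fst s')(ri := i + 1), snd s') < m s'"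
        using i unfolding m_def c_def i_def by simp
      ultimately show ?thesis
        using False mem unfolding c_def i_def l_def e_def by auto
    qed
  qed
  have start: "I ((fst s)(rc := 0, ri := 0), snd s)"
    unfolding I_def covers_def by auto
  have mstart: "m ((fst s)(rc := 0, ri := 0), snd s) \<le> n * (n + 1) + n"
  proof -
    have "card ({0..<int n} \<inter> {j. 0 < e j}) \<le> card {0..<int n}" by (intro card_mono) auto
    then show ?thesis unfolding m_def by (simp del: mult_Suc_right)
  qed
  show ?thesis
    unfolding Gap_def
  proof (simp, rule wp_While[where I = I and m = m and T = 3])
    show "I ((fst s)(rc := 0, ri := 0), snd s)" by (rule start)
  next
    fix t s' assume t: "t \<le> 1 + m ((fst s)(rc := 0, ri := 0), snd s) * (3 + 1)"
      and I: "I s'" and b: "\<not> bval (Less (Reg ri) (Reg rN)) s'"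
    have "Suc (Suc t) \<le> 6 * (n + 1)\<^sup>2"
      using t mstart by (simp add: power2_eq_square)
    moreover have "fst s' ri = int n" using I b n unfolding I_def by auto
    ultimately show "Suc (Suc t) \<le> 6 * (Suc n)\<^sup>2 \<and> snd s' = snd s \<and>
      (\<forall>r. r \<noteq> rc \<and> r \<noteq> ri \<longrightarrow> fst s' r = fst s r) \<and>
      fst s' rc = first_gap (int n) (arr 1 (snd s)) (arr 2 (snd s))"
      using I first_gap_eqI[of "fst s' rc" "int n" l e] unfolding I_def l_def e_def by auto
  qed (rule step)
qed

definition Pick :: com where
  "Pick = Assign rs (N (- 1)) ;; Assign ri (N 0) ;;
    While (Less (Reg ri) (Reg rN))
      (If (Less (Reg rRight) (N 1))
         (Assign rNear (Load (adr 2 ri)) ;; Assign rFar (Load (adr 1 ri)))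
         (Assign rNear (Minus (N 0) (Load (adr 1 ri))) ;; Assign rFar (Minus (N 0) (Load (adr 2 ri)))) ;;
       If (And (Less (N 0) (Load (adr 3 ri))) (And (Eq (Reg rNear) (Reg rv))
            (Or (Less (Reg rs) (N 0)) (Less (Reg rFar) (Reg rBest)))))
         (Assign rs (Reg ri) ;; Assign rBest (Reg rFar))
         Skip ;;
       Assign ri (Plus (Reg ri) (N 1)))"

lemma wp_Pick:
  assumes n: "fst s rN = int n" and right: "fst s rRight = of_bool right"
  shows "wp Pick s (\<lambda>t s'. t \<le> 8 * n + 3 \<and> snd s' = snd s \<and>
    (\<forall>r. r \<notin> {ri, rs, rNear, rFar, rBest} \<longrightarrow> fst s' r = fst s r) \<and>
    fst s' rs = pick (near_end right (arr 1 (snd s)) (arr 2 (snd s)))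
      (far_end right (arr 1 (snd s)) (arr 2 (snd s))) (arr 3 (snd s)) (fst s rv) n)"
proof -
  define near far where "near = near_end right (arr 1 (snd s)) (arr 2 (snd s))"
    and "far = far_end right (arr 1 (snd s)) (arr 2 (snd s))"
  define p where "p = pick near far (arr 3 (snd s)) (fst s rv)"
  \<comment> \<open>\<open>rBest\<close> has a meaning only after a successful pick; until then the
    test \<open>rs < 0\<close> decides.\<close>
  define I where "I s' \<longleftrightarrow> snd s' = snd s \<and> (\<forall>r. r \<notin> {ri, rs, rNear, rFar, rBest} \<longrightarrow> fst s' r = fst s r) \<and>
     0 \<le> fst s' ri \<and> fst s' ri \<le> int n \<and> fst s' rs = p (nat (fst s' ri)) \<and>
     (0 \<le> fst s' rs \<longrightarrow> fst s' rBest = far (fst s' rs))" for s' :: state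
  define m where "m s' = nat (int n - fst s' ri)" for s' :: state
  show ?thesis
    unfolding Pick_def
  proof (simp, rule wp_While[where I = I and m = m and T = 7], goal_cases)
    case 1
    show ?case unfolding I_def p_def by simp
  next
    case (2 s')
    define i where "i = nat (fst s' ri)"
    have i: "fst s' ri = int i" "i < n" using 2 n unfolding I_def i_def by auto
    have *: "nat (int i + 1) = Suc i" by simp
    have f: "snd s' = snd s" "\<And>r. r \<notin> {ri, rs, rNear, rFar, rBest} \<Longrightarrow> fst s' r = fst s r"
      "fst s' rs = p i" "0 \<le> p i \<longrightarrow> fst s' rBest = far (p i)"
      using 2 i unfolding I_def by auto
    have ps: "p (Suc i) = (if 0 < arr 3 (snd s) (int i) \<and> near (int i) = fst s rv \<and>
        (p i < 0 \<or> far (int i) < far (p i)) then int i else p i)"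
      unfolding p_def by simp
    have best: "p i < 0 \<or> far (int i) < fst s' rBest \<longleftrightarrow> p i < 0 \<or> far (int i) < far (p i)"
      using f(4) by auto
    have nf: "near (int i) = (if right then - arr 1 (snd s) (int i) else arr 2 (snd s) (int i))"
      "far (int i) = (if right then - arr 2 (snd s) (int i) else arr 1 (snd s) (int i))"
      by (auto simp: near_def far_def near_end_def far_end_def)
    show ?case
    proof (cases "0 < arr 3 (snd s) (int i) \<and> near (int i) = fst s rv \<and>
        (p i < 0 \<or> far (int i) < far (p i))")
      case True
      then have "p (Suc i) = int i" unfolding ps by (rule if_P)
      then show ?thesis using True best f(4) i(2) right n unfolding I_def m_def
        by (cases right) (simp_all add: * f(1-3) i(1) nf)
    next
      case False
      then have "p (Suc i) = p i" unfolding ps by (rule if_not_P)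
      then show ?thesis using False best f(4) i(2) right n unfolding I_def m_def
        by (cases right; simp add: * f(1-3) i(1) nf; blast)
    qed
  next
    case (3 t s')
    then have "fst s' ri = int n" using n unfolding I_def by auto
    then show ?case using 3 unfolding I_def m_def p_def near_def far_def by auto
  qed
qed

section \<open>Decoding and executing one move\<close>

definition ReadUnary :: com where
  "ReadUnary = Assign ra (N 0) ;;
    While OddG (Assign ra (Plus (Reg ra) (N 1)) ;; Assign rG (Half (Reg rG))) ;;
    Assign rG (Half (Reg rG))"

lemma wp_ReadUnary:
  assumes g: "fst s rG = int g"
  shows "wp ReadUnary s (\<lambda>t s'. t \<le> 3 * ones g + 3 \<and> snd s' = snd s \<and>
    (\<forall>r. r \<notin> {ra, rG} \<longrightarrow> fst s' r = fst s r) \<and>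
    fst s' ra = int (ones g) \<and> fst s' rG = int (drop_ones g))"
proof -
  define I where "I s' \<longleftrightarrow> snd s' = snd s \<and> (\<forall>r. r \<notin> {ra, rG} \<longrightarrow> fst s' r = fst s r) \<and>
    (\<exists>g'. fst s' rG = int g' \<and> fst s' ra + int (ones g') = int (ones g) \<and> drop_ones g' = drop_ones g)"
    for s' :: state
  define m where "m s' = ones (nat (fst s' rG))" for s' :: state
  show ?thesis
    unfolding ReadUnary_def
  proof (simp, rule wp_While[where I = I and m = m and T = 2], goal_cases)
    case 1
    show ?case using g unfolding I_def by auto
  next
    case (2 s')
    then obtain g' where g': "fst s' rG = int g'" "fst s' ra + int (ones g') = int (ones g)"
      "drop_ones g' = drop_ones g" unfolding I_def by blast
    have odd: "odd g'" using 2(2) g'(1) by simp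
    have d: "int g' div 2 = int (g' div 2)" by simp
    have "ones g' = Suc (ones (g' div 2))" "drop_ones g' = drop_ones (g' div 2)"
      using odd ones.simps[of g'] drop_ones.simps[of g'] by simp_all
    then have "I ((fst s')(ra := fst s' ra + 1, rG := fst s' rG div 2), snd s')"
      "m ((fst s')(ra := fst s' ra + 1, rG := fst s' rG div 2), snd s') < m s'"
      using 2(1) g' unfolding I_def m_def g'(1) d by auto
    then show ?case by simp
  next
    case (3 t s')
    then obtain g' where g': "fst s' rG = int g'" "fst s' ra + int (ones g') = int (ones g)"
      "drop_ones g' = drop_ones g" unfolding I_def by blast
    have "even g'" using 3(3) g'(1) by simp
    then have "ones g' = 0" "drop_ones g' = g' div 2"
      using ones.simps[of g'] drop_ones.simps[of g'] by simp_all
    then show ?case using 3(1,2) g' g unfolding I_def m_def by auto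
  qed
qed

definition DecodeClass :: com where
  "DecodeClass =
    If OddG (Assign rRight (N 1) ;; Assign rv (Minus (N (- 1)) (Reg rc)))
      (Assign rRight (N 0) ;; Assign rv (Reg rc)) ;;
    Assign rG (Half (Reg rG)) ;; ReadUnary ;; Assign rv (Minus (Reg rv) (Reg ra))"

lemma wp_DecodeClass:
  assumes g: "fst s rG = int g"
  shows "wp DecodeClass s (\<lambda>t s'. t \<le> 3 * ones (g div 2) + 8 \<and> snd s' = snd s \<and>
    (\<forall>r. r \<notin> {ra, rG, rRight, rv} \<longrightarrow> fst s' r = fst s r) \<and> fst s' rRight = of_bool (odd g) \<and>
    fst s' rv = (if odd g then - 1 - fst s rc else fst s rc) - int (ones (g div 2)) \<and>
    fst s' rG = int (drop_ones (g div 2)))"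
  unfolding DecodeClass_def
  by (simp add: g, intro conjI impI; rule wp_mono[OF wp_ReadUnary[of _ "g div 2"]]) (auto simp: g)

text \<open>After a failed pick, \<open>loc 3 (- 1) = 0\<close> is the address of the number of
  sensors, so the store must be skipped.\<close>

definition Mark :: com where
  "Mark = If (Less (Reg rs) (N 0)) Skip (Store (adr 3 rs) (N 0))"

lemma wp_Mark:
  "wp Mark s (\<lambda>t s'. t = 2 \<and> fst s' = fst s \<and> (\<forall>a\<ge>0. snd s' a = snd s a) \<and>
    arr 1 (snd s') = arr 1 (snd s) \<and> arr 2 (snd s') = arr 2 (snd s) \<and>
    arr 3 (snd s') = mark (arr 3 (snd s)) (fst s rs))"
  unfolding Mark_def using loc_negative[of "fst s rs" 3] by (auto simp: mark_def)

definition Select :: com where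
  "Select = If OddG (Pick ;; Mark) Skip ;; Assign rG (Half (Reg rG)) ;; Pick"

lemma wp_Select:
  assumes n: "fst s rN = int n" and right: "fst s rRight = of_bool right" and g: "fst s rG = int g"
  defines "p \<equiv> \<lambda>u. pick (near_end right (arr 1 (snd s)) (arr 2 (snd s)))
      (far_end right (arr 1 (snd s)) (arr 2 (snd s))) u (fst s rv) n"
  defines "u1 \<equiv> if odd g then mark (arr 3 (snd s)) (p (arr 3 (snd s))) else arr 3 (snd s)"
  shows "wp Select s (\<lambda>t s'. t \<le> 16 * n + 12 \<and> (\<forall>a\<ge>0. snd s' a = snd s a) \<and>
    (\<forall>r. r \<notin> {rG, ri, rs, rNear, rFar, rBest} \<longrightarrow> fst s' r = fst s r) \<and>
    fst s' rG = int (g div 2) \<and> arr 1 (snd s') = arr 1 (snd s) \<and> arr 2 (snd s') = arr 2 (snd s) \<and>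
    arr 3 (snd s') = u1 \<and> fst s' rs = p u1)"
proof -
  have 1: "wp (If OddG (Pick ;; Mark) Skip) s (\<lambda>t s'. t \<le> 8 * n + 6 \<and> (\<forall>a\<ge>0. snd s' a = snd s a) \<and>
    (\<forall>r. r \<notin> {ri, rs, rNear, rFar, rBest} \<longrightarrow> fst s' r = fst s r) \<and>
    arr 1 (snd s') = arr 1 (snd s) \<and> arr 2 (snd s') = arr 2 (snd s) \<and> arr 3 (snd s') = u1)"
  proof (cases "odd g")
    case True
    show ?thesis
      by (simp add: g True, rule wp_mono[OF wp_Pick[OF n right]], rule wp_mono[OF wp_Mark])
        (auto simp: True u1_def p_def)
  next
    case False
    then show ?thesis by (simp add: g u1_def)
  qed
  show ?thesis
    unfolding Select_def wp_Seq wp_Assign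
    by (rule wp_mono[OF 1], rule wp_mono[OF wp_Pick[of _ n right]]) (auto simp: n right g p_def)
qed

text \<open>From here on, \<open>rRight\<close> is reused for the sign of the displacement.\<close>

definition DecodeMove :: com where
  "DecodeMove = If OddG (Assign rRight (N 1)) (Assign rRight (N 0)) ;;
    Assign rG (Half (Reg rG)) ;; ReadUnary ;; Assign rd (Plus (Reg ra) (N 1))"

lemma wp_DecodeMove:
  assumes g: "fst s rG = int g"
  shows "wp DecodeMove s (\<lambda>t s'. t \<le> 3 * ones (g div 2) + 7 \<and> snd s' = snd s \<and>
    (\<forall>r. r \<notin> {ra, rG, rRight, rd} \<longrightarrow> fst s' r = fst s r) \<and> fst s' rRight = of_bool (odd g) \<and>
    fst s' rd = 1 + int (ones (g div 2)) \<and> fst s' rG = int (drop_ones (g div 2)))"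
  unfolding DecodeMove_def
  by (simp add: g, intro conjI impI; rule wp_mono[OF wp_ReadUnary[of _ "g div 2"]]) (auto simp: g)

text \<open>A failed pick is expressed by the budget -1, which \<open>accept\<close> rejects; this
  also ends the loop around it.\<close>

definition Move :: com where
  "Move = Assign rb (Minus (Reg rb) (Reg rd)) ;;
    If (Less (N 0) (Reg rRight)) (Assign rd (Minus (N 0) (Reg rd))) Skip ;;
    If (Less (Reg rs) (N 0)) (Assign rb (N (- 1)))
      (Store (adr 1 rs) (Plus (Load (adr 1 rs)) (Reg rd)) ;;
       Store (adr 2 rs) (Plus (Load (adr 2 rs)) (Reg rd)) ;; Mark)"

lemma wp_Move:
  assumes right: "fst s rRight = of_bool neg"
  defines "d \<equiv> if neg then - fst s rd else fst s rd"
  shows "wp Move s (\<lambda>t s'. t \<le> 8 \<and> (\<forall>a\<ge>0. snd s' a = snd s a) \<and>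
    (\<forall>r. r \<notin> {rb, rd} \<longrightarrow> fst s' r = fst s r) \<and>
    (if fst s rs < 0 then fst s' rb = - 1 else
      fst s' rb = fst s rb - fst s rd \<and>
      arr 1 (snd s') = (arr 1 (snd s))(fst s rs := arr 1 (snd s) (fst s rs) + d) \<and>
      arr 2 (snd s') = (arr 2 (snd s))(fst s rs := arr 2 (snd s) (fst s rs) + d) \<and>
      arr 3 (snd s') = mark (arr 3 (snd s)) (fst s rs)))"
  using loc_negative[of "fst s rs" 1] loc_negative[of "fst s rs" 2] loc_negative[of "fst s rs" 3]
  unfolding Move_def Mark_def by (auto simp: right d_def mark_def)

section \<open>One step and one run of the search\<close>

abbreviation "acc s \<equiv> accept (fst s rN) (fst s rL) (arr 1 (snd s)) (arr 2 (snd s)) (arr 3 (snd s)) (fst s rb)"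

definition Step :: com where
  "Step = DecodeClass ;; Select ;; DecodeMove ;; Move"

lemma drop_ones_le: "drop_ones g \<le> g"
proof (induction g rule: drop_ones.induct)
  case (1 g)
  then show ?case using drop_ones.simps[of g] by (cases "odd g") (auto intro: order.trans)
qed

lemma ones_less: "g < 2 ^ k \<Longrightarrow> ones g \<le> k"
proof (induction g arbitrary: k rule: ones.induct)
  case (1 g)
  show ?case
  proof (cases "odd g")
    case True
    then obtain k' where "k = Suc k'" using 1(2) by (cases k) auto
    then show ?thesis using 1 True ones.simps[of g] by auto
  next
    case False
    then show ?thesis using ones.simps[of g] by simp
  qed
qed

text \<open>One execution is one unfolding of \<open>accept\<close>, hence \<open>acc\<close> is
  preserved. The unread number never grows, so the bound \<open>2 ^ k\<close>, and with it the cost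
  of reading unary numbers, persists through the run.\<close>

lemma wp_Step:
  assumes n: "fst s rN = int n" and g: "fst s rG = int g" "g < 2 ^ k"
    and c: "fst s rc = first_gap (int n) (arr 1 (snd s)) (arr 2 (snd s))" "fst s rc < fst s rL"
    and b: "0 \<le> fst s rb"
  shows "wp Step s (\<lambda>t s'. t \<le> 16 * n + 6 * k + 40 \<and> (\<forall>a\<ge>0. snd s' a = snd s a) \<and>
    (\<forall>r. r \<in> {rAns, rN, rL, rB, rZ, rLim, rCnt} \<longrightarrow> fst s' r = fst s r) \<and>
    (\<exists>g' < 2 ^ k. fst s' rG = int g' \<and> acc s' g' = acc s g) \<and> fst s' rb < fst s rb)"
proof -
  define g2 where "g2 = drop_ones (g div 2)"
  define g3 where "g3 = g2 div 2"
  define g5 where "g5 = drop_ones (g3 div 2)"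
  have le: "g2 \<le> g" "g3 \<le> g" "g5 \<le> g"
    using drop_ones_le[of "g div 2"] drop_ones_le[of "g3 div 2"] div_le_dividend[of g 2]
      div_le_dividend[of g2 2] div_le_dividend[of g3 2] unfolding g2_def g3_def g5_def by linarith+
  have t: "ones (g div 2) \<le> k" "ones (g3 div 2) \<le> k"
    using g(2) le by (auto intro!: ones_less)
  show ?thesis
    unfolding Step_def wp_Seq
    apply (rule wp_mono[OF wp_DecodeClass[OF g(1)]])
    apply (rule wp_mono[OF wp_Select[of _ n "odd g" g2]])
       apply (simp add: n)
      apply simp
     apply (simp add: g2_def)
    apply (rule wp_mono[OF wp_DecodeMove[of _ g3]])
     apply (simp add: g3_def)
    apply (rule wp_mono[OF wp_Move[of _ "odd g3"]])
     apply simp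
    subgoal premises prems for t1 s1 t2 s2 t3 s3 t4 s4
    proof -
      define l e where "l = arr 1 (snd s)" and "e = arr 2 (snd s)"
      define p where "p = (\<lambda>u. pick (near_end (odd g) l e) (far_end (odd g) l e) u
        ((if odd g then - 1 - fst s rc else fst s rc) - int (ones (g div 2))) n)"
      define u1 where "u1 = (if odd g2 then mark (arr 3 (snd s)) (p (arr 3 (snd s))) else arr 3 (snd s))"
      define m where "m = 1 + int (ones (g3 div 2))"
      define d where "d = (if odd g3 then - m else m)"
      note 1 = prems(1)
      have 2: "t2 \<le> 16 * n + 12" "\<forall>a\<ge>0. snd s2 a = snd s a"
        "\<And>r. r \<notin> {rG, ri, rs, rNear, rFar, rBest} \<Longrightarrow> fst s2 r = fst s1 r"
        "fst s2 rG = int g3" "arr 1 (snd s2) = l" "arr 2 (snd s2) = e" "arr 3 (snd s2) = u1"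
        "fst s2 rs = p u1"
        using prems(1,2) unfolding l_def e_def u1_def p_def g3_def by simp_all
      have 3: "t3 \<le> 3 * ones (g3 div 2) + 7" "snd s3 = snd s2"
        "\<And>r. r \<notin> {ra, rG, rRight, rd} \<Longrightarrow> fst s3 r = fst s2 r"
        "fst s3 rd = m" "fst s3 rG = int g5"
        using prems(3) unfolding m_def g5_def by simp_all
      have 4: "t4 \<le> 8" "\<forall>a\<ge>0. snd s4 a = snd s3 a" "\<And>r. r \<notin> {rb, rd} \<Longrightarrow> fst s4 r = fst s3 r"
        using prems(4) by simp_all
      have 5: "if p u1 < 0 then fst s4 rb = - 1 else fst s4 rb = fst s rb - m \<and>
          arr 1 (snd s4) = l(p u1 := l (p u1) + d) \<and> arr 2 (snd s4) = e(p u1 := e (p u1) + d) \<and>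
          arr 3 (snd s4) = mark u1 (p u1)"
        using prems(1,4) 2 3 unfolding d_def by simp
      have acc: "acc s g \<longleftrightarrow> 0 \<le> p u1 \<and> accept (int n) (fst s rL) (l(p u1 := l (p u1) + d))
          (e(p u1 := e (p u1) + d)) (mark u1 (p u1)) (fst s rb - m) g5"
        using b c unfolding accept.simps[of _ _ _ _ _ _ g] Let_def p_def u1_def d_def m_def g5_def g3_def g2_def l_def e_def
        by (simp add: n)
      have frame: "fst s4 r = fst s r" if "r \<in> {rAns, rN, rL, rB, rZ, rLim, rCnt}" for r
        using that prems(1) 2(3) 3(3) 4(3) by auto
      have "acc s4 g5 = acc s g"
      proof (cases "p u1 < 0")
        case True
        then show ?thesis using 5 acc by (simp add: accept.simps[of _ _ _ _ _ _ g5])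
      next
        case False
        then show ?thesis using 5 acc frame[of rN] frame[of rL] n by simp
      qed
      moreover have "fst s4 rb < fst s rb" using 5 b unfolding m_def by (auto split: if_splits)
      moreover have "fst s4 rG = int g5" using 4(3) 3(5) by simp
      moreover have "g5 < 2 ^ k" using g(2) le by simp
      moreover have "t1 + (t2 + (t3 + t4)) \<le> 16 * n + 6 * k + 40" using 1 2(1) 3(1) 4(1) t by simp
      ultimately show ?thesis using frame 2(2) 3(2) 4(2) by auto
    qed
    done
qed

text \<open>The answer register is raised to 1 and never lowered, so over all bit strings it
  accumulates the disjunction.\<close>

definition Sim :: com where
  "Sim = Assign rG (Reg rCnt) ;; Assign rb (Reg rB) ;; Gap ;;
    While (And (Not (Less (Reg rb) (N 0))) (Less (Reg rc) (Reg rL))) (Step ;; Gap) ;;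
    If (Less (Reg rb) (N 0)) Skip (Assign rAns (N 1))"

lemma wp_Sim:
  assumes n: "fst s rN = int n" and g: "fst s rCnt = int g" "g < 2 ^ k" and B: "fst s rB = int B"
  shows "wp Sim s (\<lambda>t s'. t \<le> (B + 1) * (16 * n + 6 * k + 41 + 6 * (n + 1)\<^sup>2) + 6 * (n + 1)\<^sup>2 + 5 \<and>
    (\<forall>a\<ge>0. snd s' a = snd s a) \<and>
    (\<forall>r. r \<in> {rN, rL, rB, rZ, rLim, rCnt} \<longrightarrow> fst s' r = fst s r) \<and>
    fst s' rAns = (if accept (int n) (fst s rL) (arr 1 (snd s)) (arr 2 (snd s)) (arr 3 (snd s)) (int B) g
      then 1 else fst s rAns))"
proof -
  define A where "A = accept (int n) (fst s rL) (arr 1 (snd s)) (arr 2 (snd s)) (arr 3 (snd s)) (int B) g"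
  define I where "I s' \<longleftrightarrow> (\<forall>a\<ge>0. snd s' a = snd s a) \<and>
    (\<forall>r. r \<in> {rAns, rN, rL, rB, rZ, rLim, rCnt} \<longrightarrow> fst s' r = fst s r) \<and>
    fst s' rc = first_gap (int n) (arr 1 (snd s')) (arr 2 (snd s')) \<and>
    (\<exists>g' < 2 ^ k. fst s' rG = int g' \<and> acc s' g' = A)" for s' :: state
  define m where "m s' = nat (fst s' rb + 1)" for s' :: state
  let ?T = "16 * n + 6 * k + 40 + 6 * (n + 1)\<^sup>2"
  show ?thesis
    unfolding Sim_def wp_Seq wp_Assign
  proof (rule wp_mono[OF wp_Gap[of _ n]], goal_cases)
    case 1
    show ?case using n by simp
  next
    case (2 t1 s1)
    have I1: "I s1" and b1: "fst s1 rb = int B" using 2 g n B unfolding I_def A_def by auto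
    show ?case
    proof (rule wp_While[where I = I and m = m and T = ?T], goal_cases)
      case 1
      show ?case by (rule I1)
    next
      case (2 s2)
      then obtain g' where g': "g' < 2 ^ k" "fst s2 rG = int g'" "acc s2 g' = A"
        unfolding I_def by blast
      have n2: "fst s2 rN = int n" using 2(1) n unfolding I_def by simp
      show ?case unfolding wp_Seq
      proof (rule wp_mono[OF wp_Step[OF n2 g'(2,1)]], goal_cases)
        case (4 t3 s3)
        then have n3: "fst s3 rN = int n" using n2 by simp
        show ?case
        proof (rule wp_mono[OF wp_Gap[OF n3]], goal_cases)
          case (1 t4 s4)
          from 4 obtain g'' where "g'' < 2 ^ k" "fst s3 rG = int g''" "acc s3 g'' = A"
            using g'(3) by auto
          then have "I s4" using 1 4 2(1) unfolding I_def by (auto intro!: exI[of _ g''])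
          moreover have "m s4 < m s2" using 1 4 2(2) unfolding m_def by simp
          ultimately show ?case using 1 4 by simp
        qed
      qed (use 2 in \<open>auto simp: I_def\<close>)
    next
      case (3 t2 s2)
      then obtain g' where g': "g' < 2 ^ k" "fst s2 rG = int g'" "acc s2 g' = A"
        unfolding I_def by blast
      have n2: "fst s2 rN = int n" using 3(2) n unfolding I_def by simp
      \<comment> \<open>The loop ends either with a negative budget, which means rejection, or with
        the gap at or beyond the end of the barrier.\<close>
      have Ab: "A \<longleftrightarrow> 0 \<le> fst s2 rb"
      proof (cases "fst s2 rb < 0")
        case True
        then show ?thesis using g'(3) accept_no_budget by force
      next
        case False
        then have "fst s2 rL \<le> first_gap (fst s2 rN) (arr 1 (snd s2)) (arr 2 (snd s2))"
          using 3(2,3) n2 unfolding I_def by simp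
        then show ?thesis using False g'(3) accept_covered by force
      qed
      have "m s1 = B + 1" unfolding m_def b1 by simp
      then have t: "t1 + t2 \<le> (B + 1) * (?T + 1) + 6 * (n + 1)\<^sup>2 + 1"
        using 3(1) 2 by simp
      show ?case using 3(2) t Ab unfolding A_def[symmetric] I_def by (auto simp: add.commute add.left_commute)
    qed
  qed
qed

section \<open>Setup and the loop over all bit strings\<close>

definition Reset :: com where
  "Reset = Assign ri (N 0) ;;
    While (Less (Reg ri) (Reg rN))
     (Store (adr 1 ri) (Minus (Load (Plus (N 3) (Plus (Reg ri) (Reg ri)))) (Load (Plus (N 4) (Plus (Reg ri) (Reg ri))))) ;;
      Store (adr 2 ri) (Plus (Plus (Load (Plus (N 3) (Plus (Reg ri) (Reg ri)))) (Load (Plus (N 4) (Plus (Reg ri) (Reg ri))))) (Reg rZ)) ;;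
      Store (adr 3 ri) (N 1) ;;
      Assign ri (Plus (Reg ri) (N 1)))"

text \<open>The input survives every run because only negative addresses are written, so each bit
  string can start from fresh arrays.\<close>

lemma wp_Reset:
  assumes n: "fst s rN = int n"
  shows "wp Reset s (\<lambda>t s'. t \<le> 5 * n + 2 \<and> (\<forall>a\<ge>0. snd s' a = snd s a) \<and>
    (\<forall>r. r \<noteq> ri \<longrightarrow> fst s' r = fst s r) \<and>
    (\<forall>i\<in>{0..<int n}. arr 1 (snd s') i = snd s (3 + (i + i)) - snd s (4 + (i + i)) \<and>
      arr 2 (snd s') i = snd s (3 + (i + i)) + snd s (4 + (i + i)) + fst s rZ \<and> arr 3 (snd s') i = 1))"
proof -
  define I where "I s' \<longleftrightarrow> (\<forall>a\<ge>0. snd s' a = snd s a) \<and> (\<forall>r. r \<noteq> ri \<longrightarrow> fst s' r = fst s r) \<and>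
    0 \<le> fst s' ri \<and> fst s' ri \<le> int n \<and>
    (\<forall>i\<in>{0..<fst s' ri}. arr 1 (snd s') i = snd s (3 + (i + i)) - snd s (4 + (i + i)) \<and>
      arr 2 (snd s') i = snd s (3 + (i + i)) + snd s (4 + (i + i)) + fst s rZ \<and> arr 3 (snd s') i = 1)"
    for s' :: state
  define m where "m s' = nat (int n - fst s' ri)" for s' :: state
  show ?thesis
    unfolding Reset_def
  proof (simp, rule wp_While[where I = I and m = m and T = 4], goal_cases)
    case 1
    show ?case unfolding I_def by simp
  next
    case (2 s')
    define i where "i = fst s' ri"
    have i: "0 \<le> i" "i < int n" using 2 n unfolding I_def i_def by auto
    have neg: "loc 1 i < 0" "loc 2 i < 0" "loc 3 i < 0" using loc_negative i by auto
    have ld: "snd s' (3 + (i + i)) = snd s (3 + (i + i))" "snd s' (4 + (i + i)) = snd s (4 + (i + i))"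
      using 2(1) i unfolding I_def by auto
    have ne: "3 + (i + i) \<noteq> loc 1 i" "4 + (i + i) \<noteq> loc 1 i" using neg i by auto
    have set: "{0..<i + 1} = insert i {0..<i}" using i by auto
    have z: "fst s' rZ = fst s rZ" using 2(1) unfolding I_def by simp
    define M where "M = (snd s')(loc 1 i := snd s (3 + (i + i)) - snd s (4 + (i + i)),
      loc 2 i := snd s (3 + (i + i)) + snd s (4 + (i + i)) + fst s rZ, loc 3 i := 1)"
    have "I ((fst s')(ri := i + 1), M)"
      using 2(1) i neg unfolding I_def M_def i_def[symmetric] by (auto simp: set)
    moreover have "m ((fst s')(ri := i + 1), M) < m s'"
      using i unfolding m_def i_def by simp
    ultimately show ?case using ne ld z unfolding M_def i_def by (simp add: aval.simps(3))
  next
    case (3 t s')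
    then have "fst s' ri = int n" using n unfolding I_def by auto
    then show ?case using 3 unfolding I_def m_def by auto
  qed
qed

text \<open>Expressions offer no multiplication, so the power of two is built by \<open>B\<close>
  rounds of \<open>2 B + 3\<close> doublings.\<close>

definition Limit :: com where
  "Limit = Assign rLim (N 1) ;; Assign ri (N 0) ;;
    While (Less (Reg ri) (Reg rB))
     (Assign rs (N 0) ;;
      While (Less (Reg rs) (Plus (Plus (Reg rB) (Reg rB)) (N 3)))
       (Assign rLim (Plus (Reg rLim) (Reg rLim)) ;; Assign rs (Plus (Reg rs) (N 1))) ;;
      Assign ri (Plus (Reg ri) (N 1)))"

lemma wp_Limit:
  assumes B: "fst s rB = int B"
  shows "wp Limit s (\<lambda>t s'. t \<le> B * (6 * B + 13) + 3 \<and> snd s' = snd s \<and>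
    (\<forall>r. r \<notin> {rLim, ri, rs} \<longrightarrow> fst s' r = fst s r) \<and> fst s' rLim = 2 ^ (B * (2 * B + 3)))"
proof -
  define I where "I s' \<longleftrightarrow> snd s' = snd s \<and> (\<forall>r. r \<notin> {rLim, ri, rs} \<longrightarrow> fst s' r = fst s r) \<and>
    (\<exists>i\<le>B. fst s' ri = int i \<and> fst s' rLim = 2 ^ (i * (2 * B + 3)))" for s' :: state
  define m where "m s' = nat (int B - fst s' ri)" for s' :: state
  show ?thesis
    unfolding Limit_def
  proof (simp, rule wp_While[where I = I and m = m and T = "6 * B + 12"], goal_cases)
    case 1
    show ?case unfolding I_def by simp
  next
    case (2 s1)
    then obtain i where i: "i < B" "fst s1 ri = int i" "fst s1 rLim = 2 ^ (i * (2 * B + 3))"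
      using B unfolding I_def by auto
    define J where "J s' \<longleftrightarrow> snd s' = snd s \<and> (\<forall>r. r \<notin> {rLim, ri, rs} \<longrightarrow> fst s' r = fst s r) \<and>
      fst s' ri = int i \<and> (\<exists>j\<le>2 * B + 3. fst s' rs = int j \<and> fst s' rLim = 2 ^ (i * (2 * B + 3) + j))"
      for s' :: state
    define m' where "m' s' = nat (int (2 * B + 3) - fst s' rs)" for s' :: state
    show ?case
    proof (simp, rule wp_While[where I = J and m = m' and T = 2], goal_cases)
      case 1
      show ?case using 2(1) i unfolding I_def J_def by auto
    next
      case (2 s2)
      then obtain j where j: "fst s2 rs = int j" "fst s2 rLim = 2 ^ (i * (2 * B + 3) + j)"
        unfolding J_def by blast
      have "j < 2 * B + 3" using 2 j B unfolding J_def by simp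
      then have "J ((fst s2)(rLim := fst s2 rLim + fst s2 rLim, rs := fst s2 rs + 1), snd s2)"
        using 2(1) j unfolding J_def by (auto intro!: exI[of _ "Suc j"])
      then show ?case using j \<open>j < 2 * B + 3\<close> unfolding m'_def by simp
    next
      case (3 t s2)
      then obtain j where j: "j \<le> 2 * B + 3" "fst s2 rs = int j" "fst s2 rLim = 2 ^ (i * (2 * B + 3) + j)"
        unfolding J_def by blast
      then have "j = 2 * B + 3" using 3 B unfolding J_def by simp
      then have "I ((fst s2)(ri := fst s2 ri + 1), snd s2)"
        using 3(2) j i unfolding I_def J_def by (auto intro!: exI[of _ "Suc i"] simp: add.commute)
      then show ?case using 3(1,2) i unfolding m_def m'_def J_def by simp
    qed
  next
    case (3 t s1)
    then obtain i where i: "i \<le> B" "fst s1 ri = int i" "fst s1 rLim = 2 ^ (i * (2 * B + 3))"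
      unfolding I_def by blast
    then have "i = B" using 3 B unfolding I_def by simp
    then show ?case using i 3(1,2) unfolding I_def m_def by (auto simp: add.commute)
  qed
qed

definition Setup :: com where
  "Setup = Assign rN (Load (N 0)) ;; Assign rL (Load (N 1)) ;; Assign rB (Load (N 2)) ;;
    If (Less (Reg rL) (N 1)) (Assign rL (N 1) ;; Assign rZ (N 1)) Skip"

definition Prog :: com where
  "Prog = Setup ;; Limit ;;
    While (Less (Reg rCnt) (Reg rLim)) (Reset ;; Sim ;; Assign rCnt (Plus (Reg rCnt) (N 1)))"

lemma init_state_header:
  "snd (init_state sens L B) 0 = int (length sens)" "snd (init_state sens L B) 1 = int L"
  "snd (init_state sens L B) 2 = int B"
  by (simp_all add: init_state_def)

lemma init_state_sensor:
  assumes "i < length sens"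
  shows "snd (init_state sens L B) (3 + (int i + int i)) = int (fst (sens ! i))"
    "snd (init_state sens L B) (4 + (int i + int i)) = int (snd (sens ! i))"
proof -
  have "nat (3 + (int i + int i) - 3) = 2 * i" "nat (4 + (int i + int i) - 3) = Suc (2 * i)" by simp_all
  then show "snd (init_state sens L B) (3 + (int i + int i)) = int (fst (sens ! i))"
    "snd (init_state sens L B) (4 + (int i + int i)) = int (snd (sens ! i))"
    unfolding init_state_def using assms by simp_all
qed

lemma wp_Prog:
  fixes sens :: "(nat \<times> nat) list" and L B :: nat
  defines "n \<equiv> length sens" and "K \<equiv> B * (2 * B + 3)"
  shows "wp Prog (init_state sens L B) (\<lambda>t s'.
    t \<le> B * (6 * B + 13) + 10 + 2 ^ K * ((B + 1) * (16 * n + 6 * K + 41 + 6 * (n + 1)\<^sup>2) + 6 * (n + 1)\<^sup>2 + 5 * n + 9) \<and>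
    (fst s' rAns = 1 \<longleftrightarrow> barrier_coverage sens L B))"
proof -
  define M where "M = snd (init_state sens L B)"
  note mem = init_state_header[where sens = sens and L = L and B = B, folded M_def n_def]
    init_state_sensor[where sens = sens and L = L and B = B, folded M_def n_def]
  define z :: int where "z = (if L = 0 then 1 else 0)"
  define l where "l i = M (3 + (i + i)) - M (4 + (i + i))" for i
  define e where "e i = M (3 + (i + i)) + M (4 + (i + i)) + z" for i
  define A where "A g \<longleftrightarrow> accept (int n) (max 1 (int L)) l e (\<lambda>_. 1) (int B) g" for g
  have solv: "barrier_coverage sens L B \<longleftrightarrow> (\<exists>g < 2 ^ K. A g)"
  proof -
    have "barrier_coverage sens L B \<longleftrightarrow> solvable (int n) (max 1 (int L)) l e (\<lambda>_. 1) (int B)"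
      unfolding n_def by (rule barrier_coverage_iff_solvable)
        (use mem in \<open>auto simp: l_def e_def z_def n_def\<close>)
    also have "\<dots> \<longleftrightarrow> (\<exists>g < 2 ^ K. A g)"
      unfolding A_def K_def by (rule solvable_iff_accept) auto
    finally show ?thesis .
  qed
  define S where "S s \<longleftrightarrow> (\<forall>a\<ge>0. snd s a = M a) \<and> fst s rN = int n \<and> fst s rL = max 1 (int L) \<and>
    fst s rB = int B \<and> fst s rZ = z" for s :: state
  define I where "I s \<longleftrightarrow> S s \<and> fst s rLim = 2 ^ K \<and>
    (\<exists>h\<le>2 ^ K. fst s rCnt = int h \<and> fst s rAns = of_bool (\<exists>g<h. A g))" for s :: state
  define m where "m s = nat (2 ^ K - fst s rCnt)" for s :: state
  let ?T = "(B + 1) * (16 * n + 6 * K + 41 + 6 * (n + 1)\<^sup>2) + 6 * (n + 1)\<^sup>2 + 5 * n + 8"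
  have pre: "wp Setup (init_state sens L B)
    (\<lambda>t s. t \<le> 6 \<and> S s \<and> fst s rCnt = 0 \<and> fst s rAns = 0)"
    using mem(1-3) unfolding M_def Setup_def by (auto simp: aval.simps(3) S_def z_def M_def) (auto simp: init_state_def)
  have body: "wp (Reset ;; Sim ;; Assign rCnt (Plus (Reg rCnt) (N 1))) s (\<lambda>t s'. t \<le> ?T \<and> I s' \<and> m s' < m s)"
    if Is: "I s" and b: "bval (Less (Reg rCnt) (Reg rLim)) s" for s
  proof -
    obtain h where h: "fst s rCnt = int h" "fst s rAns = of_bool (\<exists>g<h. A g)" and Ss: "S s"
      and lim: "fst s rLim = 2 ^ K"
      using Is unfolding I_def by blast
    have hK: "h < 2 ^ K"
    proof -
      have "int h < int (2 ^ K)" using b h(1) lim by simp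
      then show ?thesis by (simp only: of_nat_less_iff)
    qed
    have nS: "fst s rN = int n" using Ss unfolding S_def by simp
    show ?thesis unfolding wp_Seq wp_Assign
    proof (rule wp_mono[OF wp_Reset[OF nS]], goal_cases)
      case (1 t1 s1)
      have 1: "t1 \<le> 5 * n + 2" "S s1" "fst s1 rCnt = int h" "fst s1 rAns = fst s rAns" "fst s1 rLim = 2 ^ K"
        "\<And>i. i \<in> {0..<int n} \<Longrightarrow> arr 1 (snd s1) i = l i" "\<And>i. i \<in> {0..<int n} \<Longrightarrow> arr 2 (snd s1) i = e i"
        "\<And>i. i \<in> {0..<int n} \<Longrightarrow> arr 3 (snd s1) i = 1"
        using 1 Ss h(1) lim unfolding S_def l_def e_def by auto
      have acc: "accept (int n) (fst s1 rL) (arr 1 (snd s1)) (arr 2 (snd s1)) (arr 3 (snd s1)) (int B) h = A h"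
        using 1(2) accept_cong[of "int n" "arr 1 (snd s1)" l "arr 2 (snd s1)" e "arr 3 (snd s1)" "\<lambda>_. 1"] 1(6-8)
        unfolding A_def S_def by simp
      have nB: "fst s1 rN = int n" "fst s1 rB = int B" using 1(2) unfolding S_def by simp_all
      show ?case
      proof (rule wp_mono[OF wp_Sim[OF nB(1) 1(3) hK nB(2)]], goal_cases)
        case (1 t2 s2)
        have S2: "S s2" using 1 \<open>S s1\<close> unfolding S_def by auto
        have "fst s2 rCnt = int h" "fst s2 rLim = 2 ^ K" using 1 \<open>fst s1 rCnt = int h\<close> \<open>fst s1 rLim = 2 ^ K\<close> by simp_all
        moreover have "fst s2 rAns = of_bool (\<exists>g<Suc h. A g)"
          using 1 acc h(2) \<open>fst s1 rAns = fst s rAns\<close> by (auto simp: less_Suc_eq)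
        ultimately have "I ((fst s2)(rCnt := fst s2 rCnt + 1), snd s2)"
          using S2 hK unfolding I_def by (intro conjI exI[of _ "Suc h"]) (simp_all add: S_def)
        moreover have "m ((fst s2)(rCnt := fst s2 rCnt + 1), snd s2) < m s"
          using h(1) b lim \<open>fst s2 rCnt = int h\<close> unfolding m_def by simp
        moreover have "t1 + (t2 + 1) \<le> ?T" using 1 \<open>t1 \<le> 5 * n + 2\<close> by simp
        ultimately show ?case by simp
      qed
    qed
  qed
  show ?thesis
    unfolding Prog_def wp_Seq[of Setup]
  proof (rule wp_mono[OF pre], subst wp_Seq, goal_cases)
    case (1 t1 s1)
    then have B1: "fst s1 rB = int B" unfolding S_def by simp
    show ?case
    proof (rule wp_mono[OF wp_Limit[OF B1]], goal_cases)
      case (1 t2 s2)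
      have S2: "S s2" using 1 \<open>t1 \<le> 6 \<and> S s1 \<and> fst s1 rCnt = 0 \<and> fst s1 rAns = 0\<close>
        unfolding S_def by simp
      have I2: "I s2" "fst s2 rCnt = 0"
        using S2 1 \<open>t1 \<le> 6 \<and> S s1 \<and> fst s1 rCnt = 0 \<and> fst s1 rAns = 0\<close> unfolding I_def K_def by auto
      have m2: "m s2 = 2 ^ K" unfolding m_def I2(2) by (simp add: nat_power_eq)
      show ?case
      proof (rule wp_While[where I = I and m = m and T = ?T], goal_cases)
        case 1
        show ?case by (rule I2)
      next
        case (2 s)
        then show ?case by (rule body)
      next
        case (3 t s)
        then obtain h where h: "h \<le> 2 ^ K" "fst s rCnt = int h" "fst s rAns = of_bool (\<exists>g<h. A g)"
          and lim: "fst s rLim = 2 ^ K"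
          unfolding I_def by blast
        have "h = 2 ^ K"
        proof -
          have "int (2 ^ K) \<le> int h" using 3(3) h(2) lim by simp
          then show ?thesis using h(1) by (simp only: of_nat_le_iff)
        qed
        then have "fst s rAns = 1 \<longleftrightarrow> barrier_coverage sens L B" using h(3) solv by simp
        moreover have "?T + 1 = (B + 1) * (16 * n + 6 * K + 41 + 6 * (n + 1)\<^sup>2) + 6 * (n + 1)\<^sup>2 + 5 * n + 9"
          by simp
        moreover have "t1 + (t2 + t) \<le> B * (6 * B + 13) + 10 + 2 ^ K * (?T + 1)"
          using 3(1) 1 \<open>t1 \<le> 6 \<and> S s1 \<and> fst s1 rCnt = 0 \<and> fst s1 rAns = 0\<close> unfolding m2 by linarith
        ultimately show ?case by (simp only: simp_thms)
      qed
    qed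
  qed
qed

lemma two_power_ge: "Suc n \<le> 2 ^ n"
  by (rule Suc_leI) (rule less_exp)

text \<open>One factor \<open>2 ^ K\<close> counts the bit strings; another one and
  \<open>2 ^ B\<close> absorb the polynomial factors \<open>K + 1\<close> and \<open>B + 1\<close>.
  The exponent \<open>2 K + B = 4 B^2 + 7 B\<close> exceeds the claimed one only for
  \<open>B = 1\<close> and \<open>B = 2\<close>, by at most 7, which the factor \<open>2 ^ 9\<close>
  covers.\<close>

lemma time_bound:
  fixes n B :: nat
  defines "K \<equiv> B * (2 * B + 3)"
  shows "B * (6 * B + 13) + 10 + 2 ^ K * ((B + 1) * (16 * n + 6 * K + 41 + 6 * (n + 1)\<^sup>2) + 6 * (n + 1)\<^sup>2 + 5 * n + 9)
    \<le> 99 * 2 ^ 9 * 2 ^ (2 * B\<^sup>2 * (B + 1)) * (n + 1)\<^sup>2"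
proof -
  define W where "W = (n + 1)\<^sup>2"
  define X where "X = (B + 1) * ((K + 1) * W)"
  have W: "n + 1 \<le> W" unfolding W_def power2_eq_square by simp
  have W1: "W \<le> (K + 1) * W" and K1: "K + 1 \<le> (K + 1) * W"
    using W mult_le_mono2[of 1 W "K + 1"] by simp_all
  have KX: "(K + 1) * W \<le> X" unfolding X_def by simp
  \<comment> \<open>Here \<open>69 = 16 + 6 + 41 + 6\<close>, each unit costing at most
    \<open>(K + 1) * W\<close>. Likewise \<open>89 = 69 + 6 + 5 + 9\<close> below, and the setup
    adds 10 to reach 99.\<close>
  have "16 * n + 6 * K + 41 + 6 * W \<le> 69 * ((K + 1) * W)" using W W1 K1 by linarith
  then have "(B + 1) * (16 * n + 6 * K + 41 + 6 * W) \<le> (B + 1) * (69 * ((K + 1) * W))"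
    by (rule mult_le_mono2)
  also have "\<dots> = 69 * X" unfolding X_def by (simp only: mult.left_commute)
  finally have "(B + 1) * (16 * n + 6 * K + 41 + 6 * W) + 6 * W + 5 * n + 9 \<le> 89 * X"
    using W W1 KX by linarith
  then have a: "2 ^ K * ((B + 1) * (16 * n + 6 * K + 41 + 6 * W) + 6 * W + 5 * n + 9) \<le> 2 ^ K * (89 * X)"
    by (rule mult_le_mono2)
  have "2 ^ K * (89 * X) = 89 * (2 ^ K * X)" "2 ^ K * (10 * X) = 10 * (2 ^ K * X)" by simp_all
  note comm = this
  have "B * (6 * B + 13) \<le> 5 * K" unfolding K_def by (simp add: algebra_simps)
  then have "B * (6 * B + 13) + 10 \<le> 10 * X" using K1 KX by linarith
  also have "10 * X \<le> 2 ^ K * (10 * X)" by simp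
  finally have "B * (6 * B + 13) + 10 + 2 ^ K * ((B + 1) * (16 * n + 6 * K + 41 + 6 * W) + 6 * W + 5 * n + 9)
    \<le> 99 * (2 ^ K * X)" using a unfolding comm by linarith
  also have "X \<le> 2 ^ B * (2 ^ K * W)"
    unfolding X_def using two_power_ge[of B] two_power_ge[of K] by (intro mult_mono) auto
  then have "99 * (2 ^ K * X) \<le> 99 * (2 ^ K * (2 ^ B * (2 ^ K * W)))" by simp
  also have "\<dots> = 99 * (2 ^ (2 * K + B) * W)" by (simp only: power_add mult_2 mult.assoc mult.left_commute)
  also have "\<dots> \<le> 99 * (2 ^ (9 + 2 * B\<^sup>2 * (B + 1)) * W)"
  proof -
    have "2 * B\<^sup>2 + 7 * B \<le> 2 * B ^ 3 + 9"
    proof (cases "B \<le> 2")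
      case True
      then have "B = 0 \<or> B = 1 \<or> B = 2" by auto
      then show ?thesis by auto
    next
      case False
      then have "3 \<le> B" by simp
      then have "3 * B \<le> B * B" "3 * (B * B) \<le> B * (B * B)" by simp_all
      then show ?thesis unfolding power2_eq_square power3_eq_cube mult.assoc by linarith
    qed
    then have "2 * K + B \<le> 9 + 2 * B\<^sup>2 * (B + 1)"
      unfolding K_def power2_eq_square power3_eq_cube distrib_left distrib_right by linarith
    then show ?thesis by (intro mult_le_mono2 mult_le_mono1 power_increasing) auto
  qed
  finally show ?thesis unfolding W_def by (simp only: power_add mult.assoc)
qed

theorem theorem3:
  shows "\<exists>(P :: com) (c :: nat) (d :: nat).
           decides_in_time P barrier_coverage
             (\<lambda>sens L B. c * 2 ^ (2 * B\<^sup>2 * (B + 1)) * (length sens + 1) ^ d)"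
proof (rule exI[of _ Prog], rule exI[of _ "99 * 2 ^ 9"], rule exI[of _ 2])
  show "decides_in_time Prog barrier_coverage
    (\<lambda>sens L B. 99 * 2 ^ 9 * 2 ^ (2 * B\<^sup>2 * (B + 1)) * (length sens + 1) ^ 2)"
    unfolding decides_in_time_def
  proof (intro allI)
    fix sens L B
    from wp_Prog[of sens L B] obtain t s' where "big_step Prog (init_state sens L B) t s'"
      "t \<le> B * (6 * B + 13) + 10 + 2 ^ (B * (2 * B + 3)) * ((B + 1) *
         (16 * length sens + 6 * (B * (2 * B + 3)) + 41 + 6 * (length sens + 1)\<^sup>2) + 6 * (length sens + 1)\<^sup>2
         + 5 * length sens + 9)"
      "fst s' rAns = 1 \<longleftrightarrow> barrier_coverage sens L B"
      unfolding wp_def by blast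
    then show "\<exists>t s'. big_step Prog (init_state sens L B) t s' \<and>
        t \<le> 99 * 2 ^ 9 * 2 ^ (2 * B\<^sup>2 * (B + 1)) * (length sens + 1) ^ 2 \<and>
        (fst s' 0 = 1 \<longleftrightarrow> barrier_coverage sens L B)"
      using order.trans[OF _ time_bound[of B "length sens"]] by (intro exI conjI)
  qed
qed

end
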